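(* Let $X$ be a sequentially complete locally convex space and $\mathcal{P}$ a calibration on $X$. If $T,S\in (Q_{\mathcal{P}}(X))_{0}$ are quasi-nilpotent equivalent operators, then $T$ has the single-valued extension property (SVEP) if and only if $S$ has SVEP.
   Context: Locally convex spaces are complex and Hausdorff. A calibration on $X$ is a family $\mathcal{P}$ of seminorms generating the topology of $X$. $Q_{\mathcal{P}}(X)$ is the algebra of linear operators $T:X\to X$ such that for every $p\in\mathcal{P}$ there is $c_p>0$ with $p(Tx)\le c_p\,p(x)$ for all $x\in X$ (quotient bounded operators). For $p\in\mathcal{P}$ and $T\in Q_{\mathcal{P}}(X)$ put $\hat p(T)=\inf\{r>0 : p(Tx)\le r\,p(x)\ \forall x\in X\}$; $Q_{\mathcal{P}}(X)$ carries the topology generated by the seminorms $\hat p$, $p\in\mathcal{P}$, and a subset of $Q_{\mathcal{P}}(X)$ is bounded if each $\hat p$ is bounded on it. $(Q_{\mathcal{P}}(X))_0$ is the set of bounded elements of $Q_{\mathcal{P}}(X)$ (in the sense of Allan): those $T\in Q_{\mathcal{P}}(X)$ for which there is $\alpha>0$ such that $\{(\alpha^{-1}T)^n : n\ge 1\}$ is bounded in $Q_{\mathcal{P}}(X)$. $T\in (Q_{\mathcal{P}}(X))_0$ has SVEP if for every open set $D_f\subset\mathbb{C}$ and every analytic function $f:D_f\to X$ with $(\lambda I-T)f(\lambda)=0$ for all $\lambda\in D_f$, one has $f(\lambda)=0$ for all $\lambda\in D_f$. For $T,S\in (Q_{\mathcal{P}}(X))_0$ (not necessarily commuting) and $n\ge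 0$, $(T-S)^{[n]}=\sum_{k=0}^{n}(-1)^{n-k}\binom{n}{k}T^kS^{n-k}$. $T$ and $S$ are quasi-nilpotent equivalent if for every $p\in\mathcal{P}$, $\lim_{n\to\infty}\hat p((T-S)^{[n]})^{1/n}=0$ and $\lim_{n\to\infty}\hat p((S-T)^{[n]})^{1/n}=0$. *)

theory Defs
  imports "HOL-Analysis.Analysis"
begin

text \<open>
  There is no class of complex vector spaces in HOL-Analysis, so the scalar multiplication is an
  explicit parameter \<open>smul\<close> and the space is the whole type.  Addition is continuous and
  the topology is Hausdorff by the sort constraint.
\<close>

locale complex_lcs = vector_space smul
  for smul :: "complex \<Rightarrow> 'a::{topological_ab_group_add, t2_space} \<Rightarrow> 'a" +
  assumes continuous_smul: "continuous_on UNIV (\<lambda>(c, x). smul c x)"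
    and locally_convex: "\<And>U. open U \<Longrightarrow> 0 \<in> U \<Longrightarrow>
      \<exists>V. open V \<and> 0 \<in> V \<and> V \<subseteq> U \<and>
        (\<forall>x\<in>V. \<forall>y\<in>V. \<forall>t\<in>{0..1}.
          smul (complex_of_real t) x + smul (complex_of_real (1 - t)) y \<in> V)"

definition seq_complete :: "'a::{ab_group_add, topological_space} itself \<Rightarrow> bool" where
  "seq_complete _ \<longleftrightarrow>
    (\<forall>x :: nat \<Rightarrow> 'a.
      (\<forall>U. open U \<and> 0 \<in> U \<longrightarrow> (\<exists>N. \<forall>m\<ge>N. \<forall>n\<ge>N. x m - x n \<in> U)) \<longrightarrow>
      convergent x)"

text \<open>Nonnegativity follows from the two conditions.\<close>

definition seminorm :: "(complex \<Rightarrow> 'a::ab_group_add \<Rightarrow> 'a) \<Rightarrow> ('a \<Rightarrow> real) \<Rightarrow> bool" where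
  "seminorm smul p \<longleftrightarrow>
    (\<forall>x y. p (x + y) \<le> p x + p y) \<and> (\<forall>c x. p (smul c x) = cmod c * p x)"

text \<open>
  The seminorm balls are a subbase of the topology; the family need not be directed.
\<close>

definition calibration ::
    "(complex \<Rightarrow> 'a::{ab_group_add, topological_space} \<Rightarrow> 'a) \<Rightarrow> ('a \<Rightarrow> real) set \<Rightarrow> bool" where
  "calibration smul P \<longleftrightarrow>
    (\<forall>p\<in>P. seminorm smul p) \<and>
    (\<forall>U. open U \<longleftrightarrow> generate_topology {{y. p (y - x) < r} | p x r. p \<in> P \<and> 0 < r} U)"

definition quotient_bounded ::
    "(complex \<Rightarrow> 'a::ab_group_add \<Rightarrow> 'a) \<Rightarrow> ('a \<Rightarrow> real) set \<Rightarrow> ('a \<Rightarrow> 'a) set" where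
  "quotient_bounded smul P =
    {T. Vector_Spaces.linear smul smul T \<and> (\<forall>p\<in>P. \<exists>c>0. \<forall>x. p (T x) \<le> c * p x)}"

definition op_seminorm :: "('a \<Rightarrow> real) \<Rightarrow> ('a \<Rightarrow> 'a) \<Rightarrow> real" where
  "op_seminorm p T = Inf {r. 0 < r \<and> (\<forall>x. p (T x) \<le> r * p x)}"

definition bounded_in_quotient_bounded ::
    "(complex \<Rightarrow> 'a::ab_group_add \<Rightarrow> 'a) \<Rightarrow> ('a \<Rightarrow> real) set \<Rightarrow> ('a \<Rightarrow> 'a) set \<Rightarrow> bool" where
  "bounded_in_quotient_bounded smul P B \<longleftrightarrow>
    B \<subseteq> quotient_bounded smul P \<and> (\<forall>p\<in>P. bounded (op_seminorm p ` B))"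

definition quotient_bounded_0 ::
    "(complex \<Rightarrow> 'a::ab_group_add \<Rightarrow> 'a) \<Rightarrow> ('a \<Rightarrow> real) set \<Rightarrow> ('a \<Rightarrow> 'a) set" where
  "quotient_bounded_0 smul P =
    {T \<in> quotient_bounded smul P. \<exists>\<alpha>>0.
      bounded_in_quotient_bounded smul P
        {(\<lambda>x. smul (complex_of_real (inverse \<alpha>)) (T x)) ^^ n | n. n \<ge> 1}}"

text \<open>
  Complex differentiability at every point of \<open>D\<close>, the vector-valued counterpart of
  \<^const>\<open>analytic_on\<close> for open \<open>D\<close>.
\<close>

definition vec_analytic_on ::
    "(complex \<Rightarrow> 'a::{ab_group_add, topological_space} \<Rightarrow> 'a) \<Rightarrow> (complex \<Rightarrow> 'a) \<Rightarrow> complex set \<Rightarrow> bool"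
  where
  "vec_analytic_on smul f D \<longleftrightarrow>
    (\<forall>z\<in>D. \<exists>d. ((\<lambda>w. smul (inverse (w - z)) (f w - f z)) \<longlongrightarrow> d) (at z))"

definition svep ::
    "(complex \<Rightarrow> 'a::{ab_group_add, topological_space} \<Rightarrow> 'a) \<Rightarrow> ('a \<Rightarrow> 'a) \<Rightarrow> bool" where
  "svep smul T \<longleftrightarrow>
    (\<forall>D f. open D \<longrightarrow> vec_analytic_on smul f D \<longrightarrow>
      (\<forall>z\<in>D. smul z (f z) - T (f z) = 0) \<longrightarrow> (\<forall>z\<in>D. f z = 0))"

text \<open>\<open>bracket_power smul T S n\<close> is $(T - S)^{[n]}$.\<close>

definition bracket_power ::
    "(complex \<Rightarrow> 'a::ab_group_add \<Rightarrow> 'a) \<Rightarrow> ('a \<Rightarrow> 'a) \<Rightarrow> ('a \<Rightarrow> 'a) \<Rightarrow> nat \<Rightarrow> 'a \<Rightarrow> 'a" where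
  "bracket_power smul T S n = (\<lambda>x.
    \<Sum>k=0..n. smul ((-1) ^ (n - k) * of_nat (n choose k)) ((T ^^ k) ((S ^^ (n - k)) x)))"

definition quasi_nilpotent_equivalent ::
    "(complex \<Rightarrow> 'a::ab_group_add \<Rightarrow> 'a) \<Rightarrow> ('a \<Rightarrow> real) set \<Rightarrow> ('a \<Rightarrow> 'a) \<Rightarrow> ('a \<Rightarrow> 'a) \<Rightarrow> bool" where
  "quasi_nilpotent_equivalent smul P T S \<longleftrightarrow>
    (\<forall>p\<in>P.
      (\<lambda>n. root n (op_seminorm p (bracket_power smul T S n))) \<longlonglongrightarrow> 0 \<and>
      (\<lambda>n. root n (op_seminorm p (bracket_power smul S T n))) \<longlonglongrightarrow> 0)"

end

theory Submission
  imports Defs "HOL-Complex_Analysis.Complex_Analysis" "HOL-Real_Asymp.Real_Asymp"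
begin

text \<open>
  If \<open>f\<close> is analytic with \<open>(\<lambda> - T) f(\<lambda>) = 0\<close>, its Taylor coefficients \<open>f\<^sub>k\<close> at a point \<open>z\<close>
  satisfy \<open>(T - z) f\<^sub>0 = 0\<close> and \<open>(T - z) f\<^sub>k\<^sub>+\<^sub>1 = f\<^sub>k\<close>, and SVEP says exactly that no nonzero sequence
  of geometric growth solves these equations. Since \<open>(S - T)\<^sup>[\<^sup>n\<^sup>+\<^sup>1\<^sup>] = S (S - T)\<^sup>[\<^sup>n\<^sup>] - (S - T)\<^sup>[\<^sup>n\<^sup>] T\<close>,
  the series \<open>g = \<Sum>n. (-1)\<^sup>n (S - T)\<^sup>[\<^sup>n\<^sup>] f\<^sup>(\<^sup>n\<^sup>) / n!\<close> of Colojoara and Foias, taken coefficientwise,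
  turns such a sequence for \<open>T\<close> into one for \<open>S\<close>, and exchanging \<open>S\<close> and \<open>T\<close> inverts it because
  \<open>\<Sum>m\<le>N. (N choose m) (T - S)\<^sup>[\<^sup>m\<^sup>] (S - T)\<^sup>[\<^sup>N\<^sup>-\<^sup>m\<^sup>] = 0\<close> for \<open>N > 0\<close>. All estimates are made for one
  seminorm at a time. The vector-valued Taylor coefficients come from the scalar theory through
  the Hahn-Banach theorem and sequential completeness.
\<close>

section \<open>Sublinear functionals and the Hahn-Banach theorem\<close>

locale complex_vector_space = vector_space smul
  for smul :: "complex \<Rightarrow> 'a::ab_group_add \<Rightarrow> 'a"
begin

section \<open>Elementary properties of seminorms\<close>

lemma seminorm_triangle: "seminorm smul p \<Longrightarrow> p (x + y) \<le> p x + p y"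
  by (simp add: seminorm_def)

lemma seminorm_smul: "seminorm smul p \<Longrightarrow> p (smul c x) = cmod c * p x"
  by (simp add: seminorm_def)

lemma seminorm_zero: "seminorm smul p \<Longrightarrow> p 0 = 0"
  using seminorm_smul[of p 0 0] by simp

lemma seminorm_minus: "seminorm smul p \<Longrightarrow> p (- x) = p x"
  using seminorm_smul[of p "-1" x] by simp

lemma seminorm_nonneg: "seminorm smul p \<Longrightarrow> 0 \<le> p x"
  using seminorm_triangle[of p x "- x"] by (simp add: seminorm_zero seminorm_minus)

lemma seminorm_diff_le: "seminorm smul p \<Longrightarrow> p (x - y) \<le> p x + p y"
  using seminorm_triangle[of p x "- y"] by (simp add: seminorm_minus)

lemma seminorm_diff_commute: "seminorm smul p \<Longrightarrow> p (x - y) = p (y - x)"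
  using seminorm_minus[of p "x - y"] by simp

lemma seminorm_sum_le: "seminorm smul p \<Longrightarrow> p (sum f A) \<le> (\<Sum>a\<in>A. p (f a))"
proof (induction A rule: infinite_finite_induct)
  case (insert a A)
  then show ?case
    using seminorm_triangle[of p "f a" "sum f A"] by simp
qed (simp_all add: seminorm_zero)

section \<open>Sublinear functionals, and lowering them along a vector\<close>

definition sublinear :: "('a \<Rightarrow> real) \<Rightarrow> bool" where
  "sublinear q \<longleftrightarrow> (\<forall>x y. q (x + y) \<le> q x + q y) \<and>
    (\<forall>t>0. \<forall>x. q (smul (complex_of_real t) x) = t * q x)"

lemma sublinear_triangle: "sublinear q \<Longrightarrow> q (x + y) \<le> q x + q y"
  by (simp add: sublinear_def)

lemma sublinear_zero: "sublinear q \<Longrightarrow> q 0 = 0"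
proof -
  assume "sublinear q"
  then have "q (smul (complex_of_real 2) 0) = 2 * q 0"
    unfolding sublinear_def by (metis zero_less_numeral)
  then show ?thesis by simp
qed

lemma sublinear_scale: "sublinear q \<Longrightarrow> 0 \<le> t \<Longrightarrow> q (smul (complex_of_real t) x) = t * q x"
  by (cases "t = 0") (auto simp: sublinear_zero sublinear_def)

lemma sublinear_ge: "sublinear q \<Longrightarrow> - q (- x) \<le> q x"
  using sublinear_triangle[of q x "- x"] by (simp add: sublinear_zero)

text \<open>Applying the scaling bound for \<open>inverse t\<close> to the scaled vector yields the
  reverse inequality.\<close>

lemma sublinearI:
  assumes "\<And>x y. q (x + y) \<le> q x + q y"
    and le: "\<And>t x. 0 < t \<Longrightarrow> q (smul (complex_of_real t) x) \<le> t * q x"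
  shows "sublinear q"
  unfolding sublinear_def
proof (intro conjI allI impI)
  fix t :: real and x
  assume t: "0 < t"
  have "smul (complex_of_real (inverse t)) (smul (complex_of_real t) x) = x"
    using t by (simp flip: of_real_mult)
  then have "q x \<le> inverse t * q (smul (complex_of_real t) x)"
    using le[of "inverse t" "smul (complex_of_real t) x"] t by simp
  then have "t * q x \<le> q (smul (complex_of_real t) x)"
    using t by (simp add: field_simps)
  then show "q (smul (complex_of_real t) x) = t * q x"
    using le[OF t] by (simp add: order_antisym)
qed (use assms in auto)

lemma sublinear_seminorm: "seminorm smul p \<Longrightarrow> sublinear p"
  by (intro sublinearI) (auto simp: seminorm_triangle seminorm_smul)

text \<open>For sublinear \<open>q\<close> this is the largest sublinear functional below
  \<open>q\<close> whose value at \<open>- y\<close> is at most \<open>- q y\<close>. It serves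
  twice: to show that minimal functionals are odd, and to prescribe the value at \<open>x0\<close>
  in the Hahn-Banach theorem.\<close>

definition lower_along :: "'a \<Rightarrow> ('a \<Rightarrow> real) \<Rightarrow> 'a \<Rightarrow> real" where
  "lower_along y q x = (INF t\<in>{0..}. q (x + smul (complex_of_real t) y) - t * q y)"

context
  fixes q :: "'a \<Rightarrow> real" and y :: 'a
  assumes q: "sublinear q"
begin

lemma lower_along_le:
  assumes "0 \<le> t"
  shows "lower_along y q x \<le> q (x + smul (complex_of_real t) y) - t * q y"
  unfolding lower_along_def
proof (rule cINF_lower)
  \<comment> \<open>The bound is uniform in \<open>t\<close> because
    \<open>t * q y \<le> q (x + smul (complex_of_real t) y) + q (- x)\<close>.\<close>
  show "bdd_below ((\<lambda>t. q (x + smul (complex_of_real t) y) - t * q y) ` {0..})"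
  proof (rule bdd_belowI2)
    fix t :: real
    assume "t \<in> {0..}"
    then show "- q (- x) \<le> q (x + smul (complex_of_real t) y) - t * q y"
      using sublinear_triangle[OF q, of "x + smul (complex_of_real t) y" "- x"]
      by (simp add: sublinear_scale[OF q])
  qed
qed (use assms in auto)

lemma lower_along_greatest:
  "(\<And>t. 0 \<le> t \<Longrightarrow> b \<le> q (x + smul (complex_of_real t) y) - t * q y) \<Longrightarrow> b \<le> lower_along y q x"
  unfolding lower_along_def by (rule cINF_greatest) auto

lemma lower_along_le_self: "lower_along y q x \<le> q x"
  using lower_along_le[of 0 x] by simp

lemma lower_along_minus: "lower_along y q (- y) \<le> - q y"
  using lower_along_le[of 1 "- y"] by (simp add: sublinear_zero[OF q])

lemma sublinear_lower_along: "sublinear (lower_along y q)"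
proof (rule sublinearI)
  fix x x'
  \<comment> \<open>The parameters \<open>t\<close> and \<open>s\<close> of the two summands combine
    to \<open>t + s\<close>; the two infima are then taken one after the other.\<close>
  have "lower_along y q (x + x') \<le> (q (x + smul (complex_of_real t) y) - t * q y) +
      (q (x' + smul (complex_of_real s) y) - s * q y)" if "0 \<le> t" "0 \<le> s" for t s
  proof -
    have "x + x' + smul (complex_of_real (t + s)) y =
        (x + smul (complex_of_real t) y) + (x' + smul (complex_of_real s) y)"
      by (simp add: scale_left_distrib algebra_simps)
    then show ?thesis
      using lower_along_le[of "t + s" "x + x'"] that
        sublinear_triangle[OF q, of "x + smul (complex_of_real t) y" "x' + smul (complex_of_real s) y"]
      by (simp add: algebra_simps)
  qed
  then have "lower_along y q (x + x') - (q (x + smul (complex_of_real t) y) - t * q y)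
      \<le> lower_along y q x'" if "0 \<le> t" for t
    using that by (intro lower_along_greatest) (auto simp: diff_le_eq add.commute)
  then have "lower_along y q (x + x') - lower_along y q x' \<le> lower_along y q x"
    by (intro lower_along_greatest) (simp add: algebra_simps)
  then show "lower_along y q (x + x') \<le> lower_along y q x + lower_along y q x'"
    by simp
next
  fix s :: real and x
  assume s: "0 < s"
  have "lower_along y q (smul (complex_of_real s) x) / s \<le> lower_along y q x"
  proof (rule lower_along_greatest)
    fix t :: real
    assume t: "0 \<le> t"
    have "smul (complex_of_real s) x + smul (complex_of_real (s * t)) y =
        smul (complex_of_real s) (x + smul (complex_of_real t) y)"
      by (simp add: scale_right_distrib)
    then have "lower_along y q (smul (complex_of_real s) x) \<le>
        q (smul (complex_of_real s) (x + smul (complex_of_real t) y)) - s * t * q y"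
      using lower_along_le[of "s * t" "smul (complex_of_real s) x"] s t by simp
    also have "\<dots> = s * (q (x + smul (complex_of_real t) y) - t * q y)"
      using s by (simp add: sublinear_scale[OF q] right_diff_distrib)
    finally have "lower_along y q (smul (complex_of_real s) x) \<le>
        s * (q (x + smul (complex_of_real t) y) - t * q y)" .
    then show "lower_along y q (smul (complex_of_real s) x) / s \<le>
        q (x + smul (complex_of_real t) y) - t * q y"
      using s by (simp add: field_simps)
  qed
  then show "lower_along y q (smul (complex_of_real s) x) \<le> s * lower_along y q x"
    using s by (simp add: field_simps)
qed

end

text \<open>Subadditivity comes from the chain property: of \<open>q\<close> and \<open>q'\<close>,
  the smaller one evaluated at \<open>x + y\<close> is at most \<open>q x + q' y\<close>. The infima
  are finite since \<open>- q0 (- x) \<le> - q (- x) \<le> q x\<close>.\<close>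

lemma sublinear_chain_Inf:
  assumes "C \<noteq> {}" and sub: "\<And>q. q \<in> C \<Longrightarrow> sublinear q"
    and le: "\<And>q. q \<in> C \<Longrightarrow> q \<le> q0"
    and chain: "\<And>q q'. q \<in> C \<Longrightarrow> q' \<in> C \<Longrightarrow> q \<le> q' \<or> q' \<le> q"
  shows "sublinear (\<lambda>x. INF q\<in>C. q x)" and "q \<in> C \<Longrightarrow> (INF q\<in>C. q x) \<le> q x"
proof -
  have "bdd_below ((\<lambda>q. q x) ` C)" for x
  proof (rule bdd_belowI2)
    fix q
    assume "q \<in> C"
    then show "- q0 (- x) \<le> q x"
      using sublinear_ge[OF sub, of q x] le[of q] by (auto simp: le_fun_def intro: order_trans[rotated])
  qed
  then have lower: "(INF q\<in>C. q x) \<le> q x" if "q \<in> C" for q x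
    using that by (intro cINF_lower) auto
  then show "q \<in> C \<Longrightarrow> (INF q\<in>C. q x) \<le> q x" .
  show "sublinear (\<lambda>x. INF q\<in>C. q x)"
  proof (rule sublinearI)
    fix x y
    have "(INF q\<in>C. q (x + y)) \<le> q' y + q x" if q: "q \<in> C" "q' \<in> C" for q q'
      using chain[OF q]
    proof
      assume "q \<le> q'"
      then show ?thesis
        using lower[OF q(1), of "x + y"] sublinear_triangle[OF sub[OF q(1)], of x y]
        by (auto dest: le_funD[of _ _ y])
    next
      assume "q' \<le> q"
      then show ?thesis
        using lower[OF q(2), of "x + y"] sublinear_triangle[OF sub[OF q(2)], of x y]
        by (auto dest: le_funD[of _ _ x])
    qed
    then have "(INF q\<in>C. q (x + y)) - q x \<le> (INF q\<in>C. q y)" if "q \<in> C" for q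
      using that by (intro cINF_greatest assms(1)) (simp add: diff_le_eq)
    then have "(INF q\<in>C. q (x + y)) - (INF q\<in>C. q y) \<le> (INF q\<in>C. q x)"
      by (intro cINF_greatest assms(1)) (simp add: diff_le_eq add.commute)
    then show "(INF q\<in>C. q (x + y)) \<le> (INF q\<in>C. q x) + (INF q\<in>C. q y)"
      by simp
  next
    fix t :: real and x
    assume t: "0 < t"
    have "(INF q\<in>C. q (smul (complex_of_real t) x)) / t \<le> (INF q\<in>C. q x)"
    proof (rule cINF_greatest[OF assms(1)])
      fix q
      assume "q \<in> C"
      then show "(INF q\<in>C. q (smul (complex_of_real t) x)) / t \<le> q x"
        using lower[of q "smul (complex_of_real t) x"] sublinear_scale[OF sub, of q t x] t
        by (simp add: field_simps)
    qed
    then show "(INF q\<in>C. q (smul (complex_of_real t) x)) \<le> t * (INF q\<in>C. q x)"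
      using t by (simp add: field_simps)
  qed
qed

text \<open>Zorn's lemma for the reversed pointwise order on the sublinear functionals below
  \<open>q0\<close>. Minimality extends to all sublinear functionals, since whatever lies below
  \<open>m\<close> also lies below \<open>q0\<close>.\<close>

lemma minimal_sublinear:
  assumes q0: "sublinear q0"
  obtains m where "sublinear m" "m \<le> q0" "\<And>q. sublinear q \<Longrightarrow> q \<le> m \<Longrightarrow> q = m"
proof -
  let ?A = "{q. sublinear q \<and> q \<le> q0}"
  have "\<exists>m\<in>?A. \<forall>a\<in>?A. m \<ge> a \<longrightarrow> a = m"
  proof (rule predicate_Zorn)
    show "partial_order_on ?A (relation_of (\<ge>) ?A)"
      by (rule partial_order_on_relation_ofI) auto
    fix C
    assume "C \<in> Chains (relation_of (\<ge>) ?A)"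
    then have sub: "C \<subseteq> ?A" and chain: "\<And>q q'. q \<in> C \<Longrightarrow> q' \<in> C \<Longrightarrow> q \<le> q' \<or> q' \<le> q"
      by (auto simp: Chains_def relation_of_def)
    show "\<exists>u\<in>?A. \<forall>a\<in>C. a \<ge> u"
    proof (cases "C = {}")
      case False
      note * = sublinear_chain_Inf[of C q0, OF False _ _ chain]
      have inf: "sublinear (\<lambda>x. INF q\<in>C. q x)" "\<And>q. q \<in> C \<Longrightarrow> (\<lambda>x. INF q\<in>C. q x) \<le> q"
        using * sub by (auto simp: le_fun_def)
      obtain q where "q \<in> C"
        using False by blast
      then have "(\<lambda>x. INF q\<in>C. q x) \<le> q0"
        using sub by (intro order_trans[OF inf(2)]) auto
      with inf show ?thesis
        by (intro bexI[where x = "\<lambda>x. INF q\<in>C. q x"]) simp_all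
    qed (use q0 in auto)
  qed
  then obtain m where m: "sublinear m" "m \<le> q0" "\<And>a. a \<in> ?A \<Longrightarrow> a \<le> m \<Longrightarrow> a = m"
    by auto
  then show thesis
    by (intro that[of m]) (auto intro: order_trans)
qed

text \<open>A minimal sublinear functional \<open>m\<close> is odd, since lowering it along \<open>y\<close> does not change it.\<close>

lemma minimal_sublinear_additive:
  assumes m: "sublinear m" "\<And>q. sublinear q \<Longrightarrow> q \<le> m \<Longrightarrow> q = m"
  shows "m (x + y) = m x + m y" and "m (smul (complex_of_real t) x) = t * m x"
proof -
  have "lower_along y m = m" for y
    by (intro m(2) sublinear_lower_along m(1) le_funI lower_along_le_self)
  then have "m (- y) \<le> - m y" for y
    using lower_along_minus[OF m(1), of y] by simp
  then have odd: "m (- y) = - m y" for y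
    using sublinear_ge[OF m(1), of y] by (smt (verit))
  show "m (x + y) = m x + m y"
    using sublinear_triangle[OF m(1), of x y] sublinear_triangle[OF m(1), of "x + y" "- y"]
    by (simp add: odd)
  show "m (smul (complex_of_real t) x) = t * m x"
  proof (cases "0 \<le> t")
    case False
    then have "m (smul (complex_of_real (- t)) x) = - t * m x"
      by (intro sublinear_scale m(1)) simp
    then show ?thesis
      by (simp add: odd)
  qed (simp add: sublinear_scale[OF m(1)])
qed

text \<open>The factor 2 lets \<open>cmod\<close> be estimated by the absolute values of the real
  and imaginary parts, each of which is at most \<open>p x\<close>.\<close>

definition dominated_functional :: "('a \<Rightarrow> real) \<Rightarrow> ('a \<Rightarrow> complex) \<Rightarrow> bool" where
  "dominated_functional p \<phi> \<longleftrightarrow> (\<forall>x y. \<phi> (x + y) = \<phi> x + \<phi> y) \<and>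
    (\<forall>c x. \<phi> (smul c x) = c * \<phi> x) \<and> (\<forall>x. cmod (\<phi> x) \<le> 2 * p x)"

text \<open>The minimal functional is taken below \<open>lower_along x0 p\<close> rather than below
  \<open>p\<close>. This forces \<open>m (- x0) \<le> - p x0\<close>, and oddness turns it into
  \<open>m x0 = p x0\<close>.\<close>

theorem hahn_banach_seminorm:
  assumes p: "seminorm smul p"
  obtains \<phi> where "dominated_functional p \<phi>" "Re (\<phi> x0) = p x0"
proof -
  note sp = sublinear_seminorm[OF p]
  obtain m where m: "sublinear m" "m \<le> lower_along x0 p"
      "\<And>q. sublinear q \<Longrightarrow> q \<le> m \<Longrightarrow> q = m"
    using minimal_sublinear[OF sublinear_lower_along[OF sp]] by metis
  note add = minimal_sublinear_additive(1)[OF m(1,3)]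
  note scale = minimal_sublinear_additive(2)[OF m(1,3)]
  have neg: "m (- x) = - m x" for x
    using scale[of "-1" x] by simp
  have le: "m x \<le> p x" for x
    using m(2) lower_along_le_self[OF sp, of x0 x] by (auto simp: le_fun_def intro: order_trans)
  then have abs_le: "\<bar>m x\<bar> \<le> p x" for x
    using le[of x] le[of "- x"] by (simp add: neg seminorm_minus[OF p] abs_le_iff)
  have "m (- x0) \<le> - p x0"
    using m(2) lower_along_minus[OF sp, of x0] by (auto simp: le_fun_def intro: order_trans)
  then have x0: "m x0 = p x0"
    using le[of x0] by (simp add: neg)
  \<comment> \<open>The complex-linear functional with real part \<open>m\<close>; complex linearity
    forces this imaginary part.\<close>
  define \<phi> where "\<phi> = (\<lambda>x. Complex (m x) (- m (smul \<i> x)))"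
  have "\<phi> (smul c x) = c * \<phi> x" for c x
  proof -
    have "smul c x = smul (complex_of_real (Re c)) x + smul (complex_of_real (Im c)) (smul \<i> x)"
      by (subst complex_eq[of c]) (simp add: scale_left_distrib mult.commute)
    then have 1: "m (smul c x) = Re c * m x + Im c * m (smul \<i> x)"
      by (simp only: add scale)
    have "smul (\<i> * c) x =
        smul (complex_of_real (Re c)) (smul \<i> x) + smul (complex_of_real (- Im c)) x"
    proof -
      have "\<i> * c = complex_of_real (Re c) * \<i> + complex_of_real (- Im c)"
        by (simp add: complex_eq_iff)
      then show ?thesis
        by (simp only: scale_scale scale_left_distrib)
    qed
    then have 2: "m (smul (\<i> * c) x) = Re c * m (smul \<i> x) - Im c * m x"
      by (simp only: add scale)
    show ?thesis
      unfolding \<phi>_def by (simp add: complex_eq_iff 1 2 algebra_simps)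
  qed
  moreover have "cmod (\<phi> x) \<le> 2 * p x" for x
    using cmod_le[of "\<phi> x"] abs_le[of x] abs_le[of "smul \<i> x"]
    by (simp add: \<phi>_def seminorm_smul[OF p])
  moreover have "\<phi> (x + y) = \<phi> x + \<phi> y" for x y
    by (simp add: \<phi>_def scale_right_distrib add complex_eq_iff)
  ultimately have "dominated_functional p \<phi>"
    by (simp add: dominated_functional_def)
  then show thesis
    using that[of \<phi>] x0 by (simp add: \<phi>_def)
qed

text \<open>An arbitrary doubly indexed family is allowed so that both the recursion for bracket
  powers and their convolution identity are instances.\<close>

lemma Pascal_sum:
  "(\<Sum>m\<le>Suc N. smul (of_nat (Suc N choose m)) (c m (Suc N - m))) =
    (\<Sum>m\<le>N. smul (of_nat (N choose m)) (c (Suc m) (N - m) + c m (Suc (N - m))))"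
proof -
  \<comment> \<open>The added summand at \<open>Suc N\<close> has binomial coefficient 0; afterwards
    the summand at 0 can be split off.\<close>
  have "(\<Sum>m\<le>N. smul (of_nat (N choose m)) (c m (Suc (N - m)))) =
      (\<Sum>m\<le>Suc N. smul (of_nat (N choose m)) (c m (Suc N - m)))"
    by (simp add: Suc_diff_le)
  also have "\<dots> = c 0 (Suc N) + (\<Sum>m\<le>N. smul (of_nat (N choose Suc m)) (c (Suc m) (N - m)))"
    by (subst sum.atMost_Suc_shift) simp
  finally have *: "(\<Sum>m\<le>N. smul (of_nat (N choose m)) (c m (Suc (N - m)))) =
      c 0 (Suc N) + (\<Sum>m\<le>N. smul (of_nat (N choose Suc m)) (c (Suc m) (N - m)))" .
  have "(\<Sum>m\<le>Suc N. smul (of_nat (Suc N choose m)) (c m (Suc N - m))) =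
      c 0 (Suc N) + (\<Sum>m\<le>N. smul (of_nat (N choose m) + of_nat (N choose Suc m)) (c (Suc m) (N - m)))"
    by (subst sum.atMost_Suc_shift) simp
  then show ?thesis
    by (simp only: scale_left_distrib scale_right_distrib sum.distrib *) (simp only: add_ac)
qed

end

section \<open>Calibrated spaces\<close>

locale calibrated_space = complex_vector_space smul
  for smul :: "complex \<Rightarrow> 'a::{topological_ab_group_add, t2_space} \<Rightarrow> 'a" +
  fixes P :: "('a \<Rightarrow> real) set"
  assumes calibration: "calibration smul P"
    and seq_complete: "seq_complete TYPE('a)"
begin

lemma seminorm_P: "p \<in> P \<Longrightarrow> seminorm smul p"
  using calibration by (simp add: calibration_def)

section \<open>Convergence and completeness in terms of the seminorms\<close>

lemma tendsto_iff_seminorms: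
  "(f \<longlongrightarrow> l) F \<longleftrightarrow> (\<forall>p\<in>P. ((\<lambda>w. p (f w - l)) \<longlongrightarrow> 0) F)"
proof -
  let ?B = "{{y. p (y - x) < r} | p x r. p \<in> P \<and> 0 < r}"
  have "open = generate_topology ?B"
    using calibration by (auto simp: calibration_def)
  then have *: "(f \<longlongrightarrow> l) F \<longleftrightarrow> (\<forall>S\<in>{S \<in> ?B. l \<in> S}. eventually (\<lambda>w. f w \<in> S) F)"
    by (simp only: nhds_generated_topology filterlim_INF filterlim_principal)
  show ?thesis
  proof
    assume lim: "(f \<longlongrightarrow> l) F"
    show "\<forall>p\<in>P. ((\<lambda>w. p (f w - l)) \<longlongrightarrow> 0) F"
    proof (intro ballI tendstoI)
      fix p and e :: real
      assume "p \<in> P" "0 < e"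
      then have "{y. p (y - l) < e} \<in> {S \<in> ?B. l \<in> S}"
        using seminorm_zero[OF seminorm_P[OF \<open>p \<in> P\<close>]] by auto
      then have "eventually (\<lambda>w. f w \<in> {y. p (y - l) < e}) F"
        using lim unfolding * by blast
      then show "eventually (\<lambda>w. dist (p (f w - l)) 0 < e) F"
        using seminorm_nonneg[OF seminorm_P[OF \<open>p \<in> P\<close>]] by (auto elim: eventually_mono)
    qed
  next
    assume lim: "\<forall>p\<in>P. ((\<lambda>w. p (f w - l)) \<longlongrightarrow> 0) F"
    show "(f \<longlongrightarrow> l) F"
      unfolding *
    proof
      fix S
      assume "S \<in> {S \<in> ?B. l \<in> S}"
      then obtain p x r where p: "p \<in> P" and S: "S = {y. p (y - x) < r}" and l: "p (l - x) < r"
        by auto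
      \<comment> \<open>A subbasic ball need not be centred at \<open>l\<close>; around
        \<open>l\<close> the radius \<open>r - p (l - x)\<close> is left.\<close>
      have "eventually (\<lambda>w. p (f w - l) < r - p (l - x)) F"
        using lim p l by (intro order_tendstoD(2)[of _ 0]) auto
      then show "eventually (\<lambda>w. f w \<in> S) F"
      proof eventually_elim
        case (elim w)
        then show ?case
          using seminorm_triangle[OF seminorm_P[OF p], of "f w - l" "l - x"] by (simp add: S)
      qed
    qed
  qed
qed

lemma tendsto_seminorm_diff: "p \<in> P \<Longrightarrow> (f \<longlongrightarrow> l) F \<Longrightarrow> ((\<lambda>w. p (f w - l)) \<longlongrightarrow> 0) F"
  by (simp add: tendsto_iff_seminorms)

text \<open>The constant sequence then converges both to \<open>x\<close> and to 0, and the space is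
  Hausdorff.\<close>

lemma eq_zero_if_seminorms_zero:
  assumes "\<And>p. p \<in> P \<Longrightarrow> p x = 0"
  shows "x = 0"
proof -
  have "((\<lambda>_. x) \<longlongrightarrow> 0) sequentially"
    by (simp add: tendsto_iff_seminorms assms)
  then show ?thesis
    by (simp add: LIMSEQ_const_iff)
qed

text \<open>The Cauchy condition is convergence of the differences to 0 along the product filter, so
  it can be tested on single seminorms; there the bound with separated indices tends to 0.\<close>

lemma convergent_if_seminorms_Cauchy:
  fixes x :: "nat \<Rightarrow> 'a"
  assumes "\<And>p. p \<in> P \<Longrightarrow> \<exists>b. b \<longlonglongrightarrow> (0::real) \<and> (\<forall>m n. p (x m - x n) \<le> b m + b n)"
  shows "convergent x"
proof -
  have "((\<lambda>(n, m). x m - x n) \<longlongrightarrow> 0) (sequentially \<times>\<^sub>F sequentially)"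
    unfolding tendsto_iff_seminorms
  proof
    fix p
    assume p: "p \<in> P"
    obtain b where b: "b \<longlonglongrightarrow> (0::real)" "\<And>m n. p (x m - x n) \<le> b m + b n"
      using assms[OF p] by blast
    have "((\<lambda>y. b (snd y) + b (fst y)) \<longlongrightarrow> 0 + 0) (sequentially \<times>\<^sub>F sequentially)"
      by (intro tendsto_add filterlim_compose[OF b(1)] filterlim_fst filterlim_snd)
    then have lim: "((\<lambda>y. b (snd y) + b (fst y)) \<longlongrightarrow> 0) (sequentially \<times>\<^sub>F sequentially)"
      by simp
    have "norm (p ((case y of (n, m) \<Rightarrow> x m - x n) - 0)) \<le> b (snd y) + b (fst y)" for y
      using b(2)[of "snd y" "fst y"] seminorm_nonneg[OF seminorm_P[OF p]]
      by (simp add: case_prod_unfold)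
    then show "((\<lambda>y. p ((case y of (n, m) \<Rightarrow> x m - x n) - 0)) \<longlongrightarrow> 0) (sequentially \<times>\<^sub>F sequentially)"
      by (intro Lim_null_comparison[OF always_eventually lim]) blast
  qed
  then have "\<exists>N. \<forall>m\<ge>N. \<forall>n\<ge>N. x m - x n \<in> U" if "open U" "0 \<in> U" for U
    using that by (auto simp: eventually_prod_sequentially dest!: topological_tendstoD)
  then show ?thesis
    using seq_complete unfolding seq_complete_def by blast
qed

lemma tendsto_seminorm:
  assumes p: "p \<in> P" and lim: "(f \<longlongrightarrow> l) F"
  shows "((\<lambda>w. p (f w)) \<longlongrightarrow> p l) F"
proof (rule Lim_transform[OF tendsto_const])
  note sp = seminorm_P[OF p]
  have "norm (p (f w) - p l) \<le> p (f w - l)" for w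
    using seminorm_triangle[OF sp, of "f w - l" l] seminorm_triangle[OF sp, of "l - f w" "f w"]
    by (simp add: seminorm_diff_commute[OF sp, of l])
  then show "((\<lambda>w. p (f w) - p l) \<longlongrightarrow> 0) F"
    by (intro Lim_null_comparison[OF always_eventually tendsto_seminorm_diff[OF p lim]]) blast
qed

lemma tendsto_lipschitz:
  assumes lim: "(f \<longlongrightarrow> l) F"
    and diff: "\<And>x y. T (x - y) = T x - T y"
    and le: "\<And>p. p \<in> P \<Longrightarrow> \<exists>c. \<forall>x. p (T x) \<le> c * p x"
  shows "((\<lambda>w. T (f w)) \<longlongrightarrow> T l) F"
  unfolding tendsto_iff_seminorms
proof
  fix p
  assume p: "p \<in> P"
  obtain c where c: "\<And>x. p (T x) \<le> c * p x"
    using le[OF p] by blast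
  have lim0: "((\<lambda>w. c * p (f w - l)) \<longlongrightarrow> 0) F"
    by (intro tendsto_mult_right_zero tendsto_seminorm_diff[OF p lim])
  have "norm (p (T (f w) - T l)) \<le> c * p (f w - l)" for w
    using c[of "f w - l"] seminorm_nonneg[OF seminorm_P[OF p], of "T (f w - l)"] by (simp add: diff)
  then show "((\<lambda>w. p (T (f w) - T l)) \<longlongrightarrow> 0) F"
    by (intro Lim_null_comparison[OF always_eventually lim0]) blast
qed

lemma tendsto_smul: "(f \<longlongrightarrow> l) F \<Longrightarrow> ((\<lambda>w. smul c (f w)) \<longlongrightarrow> smul c l) F"
  by (erule tendsto_lipschitz) (auto simp: scale_right_diff_distrib seminorm_smul[OF seminorm_P])

lemma tendsto_quotient_bounded:
  assumes T: "T \<in> quotient_bounded smul P" and "(f \<longlongrightarrow> l) F"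
  shows "((\<lambda>w. T (f w)) \<longlongrightarrow> T l) F"
proof -
  interpret T: Vector_Spaces.linear smul smul T
    using T by (simp add: quotient_bounded_def)
  show ?thesis
    using T by (intro tendsto_lipschitz[OF assms(2) T.diff]) (auto simp: quotient_bounded_def)
qed

section \<open>Linearity and continuity of dominated functionals\<close>

lemma dominated_functional_diff: "dominated_functional p \<phi> \<Longrightarrow> \<phi> (x - y) = \<phi> x - \<phi> y"
  using diff_add_cancel[of x y] by (metis add_diff_cancel_right' dominated_functional_def)

lemma dominated_functional_sum: "dominated_functional p \<phi> \<Longrightarrow> \<phi> (sum f A) = (\<Sum>a\<in>A. \<phi> (f a))"
proof (induction A rule: infinite_finite_induct)
  case (insert a A)
  then show ?case
    by (simp add: dominated_functional_def)
qed (use dominated_functional_diff[of p \<phi> 0 0] in auto)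

lemma tendsto_dominated_functional:
  assumes p: "p \<in> P" and \<phi>: "dominated_functional p \<phi>" and lim: "(f \<longlongrightarrow> l) F"
  shows "((\<lambda>w. \<phi> (f w)) \<longlongrightarrow> \<phi> l) F"
proof -
  have lim0: "((\<lambda>w. 2 * p (f w - l)) \<longlongrightarrow> 0) F"
    by (intro tendsto_mult_right_zero tendsto_seminorm_diff[OF p lim])
  have "norm (\<phi> (f w) - \<phi> l) \<le> 2 * p (f w - l)" for w
    using \<phi> unfolding dominated_functional_diff[OF \<phi>, symmetric] by (simp add: dominated_functional_def)
  then have "((\<lambda>w. \<phi> (f w) - \<phi> l) \<longlongrightarrow> 0) F"
    by (intro Lim_null_comparison[OF always_eventually lim0]) blast
  then show ?thesis
    by (simp only: Lim_null[symmetric])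
qed

section \<open>Series majorized seminorm by seminorm\<close>

lemma summable_if_seminorms_summable:
  assumes "\<And>p. p \<in> P \<Longrightarrow> \<exists>a. summable a \<and> (\<forall>n. p (u n) \<le> a n)"
  shows "summable u"
  unfolding summable_iff_convergent
proof (rule convergent_if_seminorms_Cauchy)
  fix p
  assume p: "p \<in> P"
  note sp = seminorm_P[OF p]
  obtain a where a: "summable a" "\<And>n. p (u n) \<le> a n"
    using assms[OF p] by blast
  define b where "b = (\<lambda>n. \<bar>sum a {..<n} - suminf a\<bar>)"
  have "b \<longlonglongrightarrow> 0"
    unfolding b_def using a(1) by (simp add: tendsto_rabs_zero_iff LIM_zero_iff summable_LIMSEQ)
  moreover have le: "p (sum u {..<m} - sum u {..<n}) \<le> b m + b n" if "n \<le> m" for m n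
  proof -
    have "p (sum u {..<m} - sum u {..<n}) \<le> (\<Sum>i=n..<m. p (u i))"
      using that by (simp add: sum_diff_nat_ivl lessThan_atLeast0 seminorm_sum_le[OF sp])
    also have "\<dots> \<le> (\<Sum>i=n..<m. a i)"
      by (intro sum_mono a)
    also have "\<dots> = sum a {..<m} - sum a {..<n}"
      using that by (simp add: sum_diff_nat_ivl lessThan_atLeast0)
    finally show ?thesis
      by (simp add: b_def)
  qed
  moreover have "p (sum u {..<m} - sum u {..<n}) \<le> b m + b n" for m n
    using le[of n m] le[of m n] seminorm_diff_commute[OF sp, of "sum u {..<m}"] by (cases "n \<le> m") auto
  ultimately show "\<exists>b. b \<longlonglongrightarrow> 0 \<and> (\<forall>m n. p (sum u {..<m} - sum u {..<n}) \<le> b m + b n)"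
    by blast
qed

lemma seminorm_tail_le:
  assumes p: "p \<in> P" and u: "u sums s" and a: "a sums A" and le: "\<And>n. p (u n) \<le> a n"
  shows "p (s - sum u {..<n}) \<le> A - sum a {..<n}"
proof (rule LIMSEQ_le)
  note sp = seminorm_P[OF p]
  show "(\<lambda>k. p (sum u {..<k} - sum u {..<n})) \<longlonglongrightarrow> p (s - sum u {..<n})"
    using u by (intro tendsto_seminorm[OF p] tendsto_diff tendsto_const) (simp add: sums_def)
  show "(\<lambda>k. sum a {..<k} - sum a {..<n}) \<longlonglongrightarrow> A - sum a {..<n}"
    using a by (intro tendsto_diff tendsto_const) (simp add: sums_def)
  show "\<exists>N. \<forall>k\<ge>N. p (sum u {..<k} - sum u {..<n}) \<le> sum a {..<k} - sum a {..<n}"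
  proof (intro exI allI impI)
    fix k
    assume "n \<le> k"
    have "p (\<Sum>i=n..<k. u i) \<le> (\<Sum>i=n..<k. p (u i))"
      by (rule seminorm_sum_le[OF sp])
    also have "\<dots> \<le> (\<Sum>i=n..<k. a i)"
      by (intro sum_mono le)
    finally show "p (sum u {..<k} - sum u {..<n}) \<le> sum a {..<k} - sum a {..<n}"
      using \<open>n \<le> k\<close> by (simp add: sum_diff_nat_ivl lessThan_atLeast0)
  qed
qed

lemma seminorm_geometric_tail_le:
  assumes p: "p \<in> P" and u: "u sums s" and le: "\<And>n. p (u n) \<le> C * q ^ n" and q: "0 \<le> q" "q < 1"
  shows "p (s - sum u {..<n}) \<le> C * q ^ n / (1 - q)"
proof -
  have "(\<lambda>n. C * q ^ n) sums (C * (1 / (1 - q)))"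
    using q by (intro sums_mult geometric_sums) auto
  then have "p (s - sum u {..<n}) \<le> C * (1 / (1 - q)) - (\<Sum>i<n. C * q ^ i)"
    by (rule seminorm_tail_le[OF p u _ le])
  also have "\<dots> = C * q ^ n / (1 - q)"
    using q by (simp add: sum_gp_strict diff_divide_distrib right_diff_distrib flip: sum_distrib_left)
  finally show ?thesis .
qed

lemma summable_if_seminorms_geometric:
  assumes q: "0 \<le> q" "q < 1" and "\<And>p. p \<in> P \<Longrightarrow> \<exists>C. \<forall>n. p (u n) \<le> C * q ^ n"
  shows "summable u"
proof (rule summable_if_seminorms_summable)
  fix p
  assume "p \<in> P"
  then obtain C where "\<forall>n. p (u n) \<le> C * q ^ n"
    using assms by blast
  moreover have "summable (\<lambda>n. C * q ^ n)"
    using q by (intro summable_mult summable_geometric) auto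
  ultimately show "\<exists>a. summable a \<and> (\<forall>n. p (u n) \<le> a n)"
    by blast
qed

end

section \<open>Taylor coefficients of vector-valued analytic functions\<close>

text \<open>The constants depend on \<open>h\<close> only through the bound \<open>B\<close>. One
  error bound, linear in \<open>cmod t\<close>, therefore serves all functionals dominated by the
  same seminorm.\<close>

lemma holomorphic_Taylor_coeff:
  fixes h :: "complex \<Rightarrow> complex" and z :: complex
  defines "c \<equiv> \<lambda>n. (deriv ^^ n) h z / fact n"
  assumes h: "h holomorphic_on ball z r" "continuous_on (cball z r) h" and r: "0 < r"
    and B: "\<And>w. w \<in> cball z r \<Longrightarrow> cmod (h w) \<le> B"
  shows "cmod (c n) \<le> B / r ^ n"
    and "t \<noteq> 0 \<Longrightarrow> cmod t \<le> r / 2 \<Longrightarrow>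
      cmod (inverse (t ^ k) * (h (z + t) - (\<Sum>n<k. t ^ n * c n)) - c k) \<le> 2 * B / r ^ Suc k * cmod t"
proof -
  show c: "cmod (c n) \<le> B / r ^ n" for n
  proof -
    have "cmod ((deriv ^^ n) h z) \<le> fact n * B / r ^ n"
      using h r B by (intro Cauchy_inequality) (auto simp: dist_norm)
    then show ?thesis
      by (simp add: c_def norm_divide field_simps)
  qed
  have "0 \<le> cmod (h z)"
    by simp
  then have B0: "0 \<le> B"
    using B[of z] r by (smt (verit) centre_in_cball)
  assume t: "t \<noteq> 0" "cmod t \<le> r / 2"
  \<comment> \<open>The ratio of the geometric majorant of the tail; \<open>q \<le> 1 / 2\<close>
    bounds \<open>1 / (1 - q)\<close> by 2.\<close>
  define q where "q = cmod t / r"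
  have q: "0 \<le> q" "q \<le> 1 / 2"
    using t r by (auto simp: q_def field_simps)
  have "(\<lambda>n. c n * t ^ n) sums h (z + t)"
    using holomorphic_power_series[OF h(1), of "z + t"] t r by (auto simp: c_def dist_norm)
  then have tail: "(\<lambda>i. c (i + Suc k) * t ^ (i + Suc k)) sums (h (z + t) - (\<Sum>i<Suc k. c i * t ^ i))"
    by (rule sums_split_initial_segment)
  have geo: "(\<lambda>i. B * q ^ Suc k * q ^ i) sums (B * q ^ Suc k * (1 / (1 - q)))"
    using q by (intro sums_mult geometric_sums) auto
  have "cmod (c (i + Suc k) * t ^ (i + Suc k)) \<le> B * q ^ Suc k * q ^ i" for i
  proof -
    have "cmod (c (i + Suc k) * t ^ (i + Suc k)) \<le> B / r ^ (i + Suc k) * cmod t ^ (i + Suc k)"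
      unfolding norm_mult norm_power by (intro mult_right_mono c) simp
    also have "\<dots> = B * q ^ Suc k * q ^ i"
      by (simp add: q_def power_divide power_add mult_ac)
    finally show ?thesis .
  qed
  then have "cmod (\<Sum>i. c (i + Suc k) * t ^ (i + Suc k)) \<le> (\<Sum>i. B * q ^ Suc k * q ^ i)"
    using geo by (intro norm_suminf_le) (auto dest: sums_summable)
  then have "cmod (h (z + t) - (\<Sum>i<Suc k. c i * t ^ i)) \<le> B * q ^ Suc k * (1 / (1 - q))"
    using sums_unique[OF tail] sums_unique[OF geo] by simp
  also have "\<dots> \<le> B * q ^ Suc k * 2"
    using q B0 by (intro mult_left_mono) (auto simp: field_simps)
  finally have *: "cmod (h (z + t) - (\<Sum>i<Suc k. c i * t ^ i)) \<le> 2 * B * q ^ Suc k"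
    by simp
  have "inverse (t ^ k) * (h (z + t) - (\<Sum>n<k. t ^ n * c n)) - c k =
      inverse (t ^ k) * (h (z + t) - (\<Sum>i<Suc k. c i * t ^ i))"
  proof -
    have "inverse (t ^ k) * (c k * t ^ k) = c k"
      using t by simp
    then show ?thesis
      by (simp add: right_diff_distrib distrib_left mult.commute[of "c _"])
  qed
  then have "cmod (inverse (t ^ k) * (h (z + t) - (\<Sum>n<k. t ^ n * c n)) - c k) =
      inverse (cmod t ^ k) * cmod (h (z + t) - (\<Sum>i<Suc k. c i * t ^ i))"
    by (simp add: norm_mult norm_inverse norm_power)
  also have "\<dots> \<le> inverse (cmod t ^ k) * (2 * B * q ^ Suc k)"
    using * by (intro mult_left_mono) auto
  also have "\<dots> = 2 * B / r ^ Suc k * cmod t"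
    using t r by (simp add: q_def power_divide)
  finally show "cmod (inverse (t ^ k) * (h (z + t) - (\<Sum>n<k. t ^ n * c n)) - c k) \<le>
      2 * B / r ^ Suc k * cmod t" .
qed

context calibrated_space
begin

section \<open>Continuity, local bounds and scalarization of analytic functions\<close>

lemma vec_analytic_tendsto:
  assumes f: "vec_analytic_on smul f D" and z: "z \<in> D"
  shows "(f \<longlongrightarrow> f z) (at z)"
  unfolding tendsto_iff_seminorms
proof
  fix p
  assume p: "p \<in> P"
  obtain d where d: "((\<lambda>w. smul (inverse (w - z)) (f w - f z)) \<longlongrightarrow> d) (at z)"
    using f z unfolding vec_analytic_on_def by blast
  have "((\<lambda>w. cmod (w - z) * p (smul (inverse (w - z)) (f w - f z))) \<longlongrightarrow> cmod (z - z) * p d) (at z)"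
    by (intro tendsto_intros tendsto_seminorm[OF p d])
  then have "((\<lambda>w. cmod (w - z) * p (smul (inverse (w - z)) (f w - f z))) \<longlongrightarrow> 0) (at z)"
    by simp
  moreover have "eventually (\<lambda>w. p (f w - f z) = cmod (w - z) * p (smul (inverse (w - z)) (f w - f z))) (at z)"
    by (simp add: eventually_at_filter seminorm_smul[OF seminorm_P[OF p]] norm_inverse)
  ultimately show "((\<lambda>w. p (f w - f z)) \<longlongrightarrow> 0) (at z)"
    by (simp add: tendsto_cong)
qed

lemma vec_analytic_bounded:
  assumes f: "vec_analytic_on smul f D" and K: "compact K" "K \<subseteq> D" and p: "p \<in> P"
  obtains M where "0 \<le> M" "\<And>w. w \<in> K \<Longrightarrow> p (f w) \<le> M"
proof -
  have "((\<lambda>w. p (f w)) \<longlongrightarrow> p (f w)) (at w within K)" if "w \<in> K" for w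
    using K that by (intro tendsto_seminorm[OF p] tendsto_within_subset[OF vec_analytic_tendsto[OF f]]) auto
  then have "continuous_on K (\<lambda>w. p (f w))"
    by (simp add: continuous_on_def)
  then have "bounded ((\<lambda>w. p (f w)) ` K)"
    using K(1) by (intro compact_imp_bounded compact_continuous_image)
  then obtain M where M: "\<And>w. w \<in> K \<Longrightarrow> \<bar>p (f w)\<bar> \<le> M"
    by (auto simp: bounded_iff)
  show thesis
    by (rule that[of "max 0 M"]) (use M in \<open>force simp: max_def\<close>)+
qed

lemma holomorphic_dominated_functional:
  assumes f: "vec_analytic_on smul f D" and p: "p \<in> P" and \<phi>: "dominated_functional p \<phi>"
  shows "(\<lambda>w. \<phi> (f w)) holomorphic_on D"
proof (rule holomorphic_onI)
  fix z
  assume "z \<in> D"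
  then obtain d where d: "((\<lambda>w. smul (inverse (w - z)) (f w - f z)) \<longlongrightarrow> d) (at z)"
    using f unfolding vec_analytic_on_def by blast
  have "\<phi> (smul (inverse (w - z)) (f w - f z)) = (\<phi> (f w) - \<phi> (f z)) / (w - z)" for w
    using \<phi> by (simp add: dominated_functional_diff[OF \<phi>, symmetric] divide_inverse mult.commute
        dominated_functional_def)
  then have "((\<lambda>w. \<phi> (f w)) has_field_derivative \<phi> d) (at z)"
    using tendsto_dominated_functional[OF p \<phi> d] by (simp add: has_field_derivative_iff)
  then show "(\<lambda>w. \<phi> (f w)) field_differentiable at z within D"
    using field_differentiable_at_within field_differentiable_def by blast
qed

text \<open>Hahn-Banach supplies a dominated functional whose real part at \<open>x\<close> equals
  \<open>p x\<close>, so scalar estimates pass to \<open>p\<close> with the same constant.\<close>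

lemma seminorm_le_functionals:
  assumes p: "p \<in> P" and "\<And>\<phi>. dominated_functional p \<phi> \<Longrightarrow> cmod (\<phi> x) \<le> B"
  shows "p x \<le> B"
  using hahn_banach_seminorm[OF seminorm_P[OF p], of x] assms(2) complex_Re_le_cmod
  by (metis order_trans)

text \<open>
  The weak Taylor coefficients of \<open>f\<close> are represented by vectors: the quotients
  \<open>(f (z + t) - (\<Sum>n<k. t\<^sup>n x\<^sub>n)) / t\<^sup>k\<close> are Cauchy as \<open>t \<rightarrow> 0\<close>, because the Cauchy
  estimates are uniform over all functionals dominated by a given seminorm.
\<close>

theorem vec_analytic_Taylor:
  assumes f: "vec_analytic_on smul f D" and D: "cball z r \<subseteq> D" and r: "0 < r"
  obtains x where "x 0 = f z"
    "\<And>p. p \<in> P \<Longrightarrow> \<exists>M. \<forall>k. p (x k) \<le> M / r ^ k"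
    "\<And>k. (\<lambda>i. smul (inverse (complex_of_real (r / real (i + 2)) ^ k))
        (f (z + complex_of_real (r / real (i + 2))) -
          (\<Sum>n<k. smul (complex_of_real (r / real (i + 2)) ^ n) (x n)))) \<longlonglongrightarrow> x k"
proof -
  define c where "c = (\<lambda>\<phi> k. (deriv ^^ k) (\<lambda>w. \<phi> (f w)) z / fact k)"
  \<comment> \<open>Nonzero points tending to 0 with \<open>cmod (t i) \<le> r / 2\<close>, the
    range of the scalar error bound.\<close>
  define t where "t = (\<lambda>i::nat. complex_of_real (r / real (i + 2)))"
  define X where "X = (\<lambda>x k i. smul (inverse (t i ^ k)) (f (z + t i) - (\<Sum>n<k. smul (t i ^ n) (x n))))"
  have cmod_t: "cmod (t i) = r / real (i + 2)" for i
    unfolding t_def norm_of_real using r by simp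
  have t: "t i \<noteq> 0" "cmod (t i) \<le> r / 2" for i
    using r cmod_t[of i] frac_le[of r r 2 "real (i + 2)"] by auto
  have "(\<lambda>i. r / real (i + 2)) \<longlonglongrightarrow> 0"
    by real_asymp
  then have t0: "(\<lambda>i. cmod (t i)) \<longlonglongrightarrow> 0"
    by (simp only: cmod_t)
  \<comment> \<open>One constant works for all functionals dominated by \<open>p\<close>. It is
    \<open>4 * M\<close>: one factor 2 from the domination, one from the scalar error bound. The
    sequence \<open>x\<close> is arbitrary, so the estimate is available before all coefficients
    have been constructed.\<close>
  have "\<exists>M. 0 \<le> M \<and> (\<forall>\<phi> k. dominated_functional p \<phi> \<longrightarrow> cmod (c \<phi> k) \<le> M / r ^ k) \<and>
      (\<forall>x k i \<phi>. dominated_functional p \<phi> \<longrightarrow> (\<forall>n<k. \<phi> (x n) = c \<phi> n) \<longrightarrow>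
        cmod (\<phi> (X x k i) - c \<phi> k) \<le> M / r ^ Suc k * cmod (t i))" if p: "p \<in> P" for p
  proof -
    obtain M where M: "0 \<le> M" "\<And>w. w \<in> cball z r \<Longrightarrow> p (f w) \<le> M"
      using vec_analytic_bounded[OF f compact_cball D p] by blast
    have hol: "(\<lambda>w. \<phi> (f w)) holomorphic_on ball z r" "continuous_on (cball z r) (\<lambda>w. \<phi> (f w))"
      and bound: "\<And>w. w \<in> cball z r \<Longrightarrow> cmod (\<phi> (f w)) \<le> 2 * M"
      if \<phi>: "dominated_functional p \<phi>" for \<phi>
    proof -
      have "(\<lambda>w. \<phi> (f w)) holomorphic_on cball z r"
        using holomorphic_dominated_functional[OF f p \<phi>] D by (rule holomorphic_on_subset)
      then show "(\<lambda>w. \<phi> (f w)) holomorphic_on ball z r" "continuous_on (cball z r) (\<lambda>w. \<phi> (f w))"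
        by (auto intro: holomorphic_on_subset[OF _ ball_subset_cball] holomorphic_on_imp_continuous_on)
      fix w
      assume "w \<in> cball z r"
      then have "p (f w) \<le> M"
        by (rule M(2))
      moreover have "cmod (\<phi> (f w)) \<le> 2 * p (f w)"
        using \<phi> by (simp add: dominated_functional_def)
      ultimately show "cmod (\<phi> (f w)) \<le> 2 * M"
        by linarith
    qed
    have "cmod (c \<phi> k) \<le> 4 * M / r ^ k" if \<phi>: "dominated_functional p \<phi>" for \<phi> k
    proof -
      have "cmod (c \<phi> k) \<le> 2 * M / r ^ k"
        unfolding c_def by (rule holomorphic_Taylor_coeff(1)[OF hol[OF \<phi>] r bound[OF \<phi>]])
      also have "\<dots> \<le> 4 * M / r ^ k"
        using M(1) r by (intro divide_right_mono) auto
      finally show ?thesis .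
    qed
    moreover have "cmod (\<phi> (X x k i) - c \<phi> k) \<le> 4 * M / r ^ Suc k * cmod (t i)"
      if \<phi>: "dominated_functional p \<phi>" and x: "\<forall>n<k. \<phi> (x n) = c \<phi> n" for \<phi> x k i
    proof -
      have scale: "\<phi> (smul a y) = a * \<phi> y" for a y
        using \<phi> by (simp add: dominated_functional_def)
      have "\<phi> (X x k i) = inverse (t i ^ k) * (\<phi> (f (z + t i)) - (\<Sum>n<k. t i ^ n * c \<phi> n))"
        using x by (simp add: X_def scale dominated_functional_diff[OF \<phi>] dominated_functional_sum[OF \<phi>])
      then show ?thesis
        using holomorphic_Taylor_coeff(2)[OF hol[OF \<phi>] r bound[OF \<phi>] t, of i k] by (simp add: c_def)
    qed
    ultimately show ?thesis
      using M(1) by (intro exI[of _ "4 * M"]) auto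
  qed
  then obtain M where M: "\<And>p. p \<in> P \<Longrightarrow> 0 \<le> M p"
      "\<And>p \<phi> k. p \<in> P \<Longrightarrow> dominated_functional p \<phi> \<Longrightarrow> cmod (c \<phi> k) \<le> M p / r ^ k"
      "\<And>p x k i \<phi>. p \<in> P \<Longrightarrow> dominated_functional p \<phi> \<Longrightarrow> (\<forall>n<k. \<phi> (x n) = c \<phi> n) \<Longrightarrow>
        cmod (\<phi> (X x k i) - c \<phi> k) \<le> M p / r ^ Suc k * cmod (t i)"
    by metis
  \<comment> \<open>The vector \<open>y\<close> must realize the weak coefficient for all
    functionals and all seminorms at once.\<close>
  define rep where "rep = (\<lambda>k y. \<forall>p\<in>P. \<forall>\<phi>. dominated_functional p \<phi> \<longrightarrow> \<phi> y = c \<phi> k)"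
  have lim0: "(\<lambda>i. M p / r ^ Suc k * cmod (t i)) \<longlonglongrightarrow> 0" for p k
    by (intro tendsto_mult_right_zero t0)
  have "\<exists>y. rep k y" for k
  proof (induction k rule: less_induct)
    case (less k)
    \<comment> \<open>Only the values below \<open>k\<close> enter \<open>X x k\<close>, and these
      are representatives by induction.\<close>
    define x where "x = (\<lambda>n. SOME y. rep n y)"
    have "rep n (x n)" if "n < k" for n
      unfolding x_def using less[OF that] by (rule someI_ex)
    then have close: "cmod (\<phi> (X x k i) - c \<phi> k) \<le> M p / r ^ Suc k * cmod (t i)"
      if "p \<in> P" "dominated_functional p \<phi>" for p \<phi> i
      using that by (intro M(3)) (auto simp: rep_def)
    have "convergent (X x k)"
    proof (rule convergent_if_seminorms_Cauchy)
      fix p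
      assume p: "p \<in> P"
      have "p (X x k m - X x k n) \<le> M p / r ^ Suc k * cmod (t m) + M p / r ^ Suc k * cmod (t n)" for m n
      proof (rule seminorm_le_functionals[OF p])
        fix \<phi>
        assume \<phi>: "dominated_functional p \<phi>"
        show "cmod (\<phi> (X x k m - X x k n)) \<le> M p / r ^ Suc k * cmod (t m) + M p / r ^ Suc k * cmod (t n)"
          using norm_triangle_ineq4[of "\<phi> (X x k m) - c \<phi> k" "\<phi> (X x k n) - c \<phi> k"]
            close[OF p \<phi>, of m] close[OF p \<phi>, of n]
          by (simp add: dominated_functional_diff[OF \<phi>])
      qed
      with lim0 show "\<exists>b. b \<longlonglongrightarrow> 0 \<and> (\<forall>m n. p (X x k m - X x k n) \<le> b m + b n)"
        by (intro exI[of _ "\<lambda>i. M p / r ^ Suc k * cmod (t i)"]) auto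
    qed
    then obtain y where y: "X x k \<longlonglongrightarrow> y"
      by (auto simp: convergent_def)
    have "rep k y"
      unfolding rep_def
    proof (intro ballI allI impI)
      fix p \<phi>
      assume p: "p \<in> P" and \<phi>: "dominated_functional p \<phi>"
      have "(\<lambda>i. \<phi> (X x k i) - c \<phi> k) \<longlonglongrightarrow> 0"
        by (intro Lim_null_comparison[OF always_eventually lim0[of p k]] allI close p \<phi>)
      then have "(\<lambda>i. \<phi> (X x k i)) \<longlonglongrightarrow> c \<phi> k"
        by (simp only: LIM_zero_iff)
      then show "\<phi> y = c \<phi> k"
        using tendsto_dominated_functional[OF p \<phi> y] by (rule LIMSEQ_unique[rotated])
    qed
    then show ?case by blast
  qed
  then obtain x where x: "\<And>k. rep k (x k)"
    by metis
  \<comment> \<open>The limits in the induction were formed with other choices of representatives,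
    so convergence is derived afresh for the final \<open>x\<close>.\<close>
  have close: "p (X x k i - x k) \<le> M p / r ^ Suc k * cmod (t i)" if p: "p \<in> P" for p k i
  proof (rule seminorm_le_functionals[OF p])
    fix \<phi>
    assume \<phi>: "dominated_functional p \<phi>"
    then have "\<phi> (x n) = c \<phi> n" for n
      using x p by (auto simp: rep_def)
    then show "cmod (\<phi> (X x k i - x k)) \<le> M p / r ^ Suc k * cmod (t i)"
      using M(3)[OF p \<phi>, of k x i] by (simp add: dominated_functional_diff[OF \<phi>])
  qed
  show thesis
  proof (rule that[of x])
    have "x 0 - f z = 0"
    proof (rule eq_zero_if_seminorms_zero)
      fix p
      assume p: "p \<in> P"
      have "p (x 0 - f z) \<le> 0"
      proof (rule seminorm_le_functionals[OF p])
        fix \<phi>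
        assume \<phi>: "dominated_functional p \<phi>"
        then have "\<phi> (x 0) = c \<phi> 0"
          using x p by (auto simp: rep_def)
        then show "cmod (\<phi> (x 0 - f z)) \<le> 0"
          by (simp add: dominated_functional_diff[OF \<phi>] c_def)
      qed
      then show "p (x 0 - f z) = 0"
        using seminorm_nonneg[OF seminorm_P[OF p], of "x 0 - f z"] by simp
    qed
    then show "x 0 = f z" by simp
    show "\<exists>M. \<forall>k. p (x k) \<le> M / r ^ k" if p: "p \<in> P" for p
    proof (intro exI allI seminorm_le_functionals[OF p])
      fix k \<phi>
      assume \<phi>: "dominated_functional p \<phi>"
      then have "\<phi> (x k) = c \<phi> k"
        using x p by (auto simp: rep_def)
      then show "cmod (\<phi> (x k)) \<le> M p / r ^ k"
        using M(2)[OF p \<phi>] by simp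
    qed
    show "(\<lambda>i. smul (inverse (complex_of_real (r / real (i + 2)) ^ k))
        (f (z + complex_of_real (r / real (i + 2))) -
          (\<Sum>n<k. smul (complex_of_real (r / real (i + 2)) ^ n) (x n)))) \<longlonglongrightarrow> x k" for k
      unfolding tendsto_iff_seminorms
    proof
      fix p
      assume p: "p \<in> P"
      have "(\<lambda>i. p (X x k i - x k)) \<longlonglongrightarrow> 0"
        using close[OF p] seminorm_nonneg[OF seminorm_P[OF p]]
        by (intro Lim_null_comparison[OF always_eventually lim0[of p k]]) simp
      then show "(\<lambda>i. p (smul (inverse (complex_of_real (r / real (i + 2)) ^ k))
        (f (z + complex_of_real (r / real (i + 2))) -
          (\<Sum>n<k. smul (complex_of_real (r / real (i + 2)) ^ n) (x n))) - x k)) \<longlonglongrightarrow> 0"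
        by (simp only: X_def t_def)
    qed
  qed
qed

text \<open>
  The shifted Taylor coefficients, with value \<open>0\<close> prepended, of an analytic family of
  eigenvectors of \<open>T\<close> around \<open>z\<close>.
\<close>

definition eigen_chain :: "('a \<Rightarrow> 'a) \<Rightarrow> complex \<Rightarrow> real \<Rightarrow> (nat \<Rightarrow> 'a) \<Rightarrow> bool" where
  "eigen_chain T z r x \<longleftrightarrow> 0 < r \<and> x 0 = 0 \<and> (\<forall>k. T (x (Suc k)) = smul z (x (Suc k)) + x k) \<and>
    (\<forall>p\<in>P. \<exists>M. \<forall>k. p (x k) \<le> M / r ^ k)"

text \<open>Since \<open>f (z + t)\<close> is an eigenvector for \<open>z + t\<close>, the operator
  \<open>T - z\<close> maps the quotient of order \<open>Suc m\<close> to the quotient of order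
  \<open>m\<close>, provided the equations for smaller indices hold. Strong induction and passage to
  the limit give the chain.\<close>

lemma eigen_chain_Taylor:
  assumes T: "T \<in> quotient_bounded smul P" and f: "vec_analytic_on smul f D" and D: "open D"
    and eig: "\<And>w. w \<in> D \<Longrightarrow> T (f w) = smul w (f w)" and z: "z \<in> D"
  obtains x r where "eigen_chain T z r x" "x 1 = f z"
proof -
  interpret T: Vector_Spaces.linear smul smul T
    using T by (simp add: quotient_bounded_def)
  obtain r where r: "0 < r" "cball z r \<subseteq> D"
    using D z open_contains_cball by blast
  define t where "t = (\<lambda>i::nat. complex_of_real (r / real (i + 2)))"
  obtain y where y0: "y 0 = f z"
    and bound: "\<And>p. p \<in> P \<Longrightarrow> \<exists>M. \<forall>k. p (y k) \<le> M / r ^ k"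
    and "\<And>k. (\<lambda>i. smul (inverse (complex_of_real (r / real (i + 2)) ^ k))
        (f (z + complex_of_real (r / real (i + 2))) -
          (\<Sum>n<k. smul (complex_of_real (r / real (i + 2)) ^ n) (y n)))) \<longlonglongrightarrow> y k"
    using vec_analytic_Taylor[OF f r(2,1)] by blast
  then have lim: "(\<lambda>i. smul (inverse (t i ^ k)) (f (z + t i) - (\<Sum>n<k. smul (t i ^ n) (y n)))) \<longlonglongrightarrow> y k" for k
    by (simp only: t_def)
  have cmod_t: "cmod (t i) = r / real (i + 2)" for i
    unfolding t_def norm_of_real using r by simp
  have t: "t i \<noteq> 0" "z + t i \<in> D" for i
  proof -
    have "z + t i \<in> cball z r"
      using r frac_le[of r r 1 "real (i + 2)"] by (simp add: dist_norm cmod_t)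
    then show "z + t i \<in> D"
      using r(2) by blast
    show "t i \<noteq> 0"
      using r cmod_t[of i] by auto
  qed
  define x where "x = case_nat 0 y"
  have x: "x 0 = 0" "x (Suc k) = y k" for k
    by (simp_all add: x_def)
  have "T (y k) - smul z (y k) = x k" for k
  proof (induction k rule: less_induct)
    case (less k)
    show ?case
    proof (cases k)
      case 0
      then show ?thesis
        by (simp add: y0 x eig z)
    next
      case (Suc m)
      have "(\<Sum>n<Suc m. smul (t i ^ n) (T (y n) - smul z (y n))) = (\<Sum>n<Suc m. smul (t i ^ n) (x n))" for i
        using less by (intro sum.cong) (auto simp: Suc)
      also have "\<dots> i = smul (t i) (\<Sum>n<m. smul (t i ^ n) (y n))" for i
        by (subst sum.lessThan_Suc_shift) (simp add: x scale_sum_right)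
      finally have sum_eq: "(\<Sum>n<Suc m. smul (t i ^ n) (T (y n) - smul z (y n))) =
          smul (t i) (\<Sum>n<m. smul (t i ^ n) (y n))" for i .
      define X where "X = (\<lambda>k i. smul (inverse (t i ^ k)) (f (z + t i) - (\<Sum>n<k. smul (t i ^ n) (y n))))"
      have "T (X k i) - smul z (X k i) = X m i" for i
      proof -
        have "T (f (z + t i)) - smul z (f (z + t i)) = smul (t i) (f (z + t i))"
          using t by (simp add: eig scale_left_distrib)
        moreover have "T (\<Sum>n<k. smul (t i ^ n) (y n)) - smul z (\<Sum>n<k. smul (t i ^ n) (y n)) =
            smul (t i) (\<Sum>n<m. smul (t i ^ n) (y n))"
          unfolding sum_eq[symmetric] Suc
          by (simp add: T.sum T.scale scale_sum_right scale_right_diff_distrib mult.commute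
              del: sum.lessThan_Suc flip: sum_subtractf)
        ultimately have "T (X k i) - smul z (X k i) =
            smul (inverse (t i ^ k)) (smul (t i) (f (z + t i)) - smul (t i) (\<Sum>n<m. smul (t i ^ n) (y n)))"
          unfolding X_def T.scale T.diff
          by (simp add: scale_right_diff_distrib scale_left_commute[of z] algebra_simps
              del: scale_scale)
        also have "\<dots> = X m i"
          using t(1)[of i] by (simp add: X_def Suc flip: scale_right_diff_distrib)
        finally show ?thesis .
      qed
      moreover have "(\<lambda>i. T (X k i) - smul z (X k i)) \<longlonglongrightarrow> T (y k) - smul z (y k)"
        using lim[of k] unfolding X_def
        by (intro tendsto_diff tendsto_quotient_bounded[OF T] tendsto_smul[of _ _ _ z])
      moreover have "X m \<longlonglongrightarrow> y m"
        using lim[of m] by (simp add: X_def)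
      ultimately show ?thesis
        by (simp add: Suc x LIMSEQ_unique)
    qed
  qed
  then have "T (x (Suc k)) = smul z (x (Suc k)) + x k" for k
    by (simp add: x diff_eq_eq add.commute)
  \<comment> \<open>Multiplying the constant by \<open>r\<close> compensates for the index shift;
    its nonnegativity covers the prepended 0.\<close>
  moreover have "\<exists>M. \<forall>k. p (x k) \<le> M / r ^ k" if p: "p \<in> P" for p
  proof -
    obtain M where M: "\<And>k. p (y k) \<le> M / r ^ k"
      using bound[OF p] by blast
    have "0 \<le> M"
      using M[of 0] seminorm_nonneg[OF seminorm_P[OF p], of "y 0"] by simp
    then have "p (x k) \<le> M * r / r ^ k" for k
      using M r by (cases k) (auto simp: x seminorm_zero[OF seminorm_P[OF p]])
    then show ?thesis by blast
  qed
  ultimately have "eigen_chain T z r x"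
    using r by (simp add: eigen_chain_def x)
  then show thesis
    using that[of r x] by (simp add: x y0)
qed

end

section \<open>SVEP in terms of Taylor coefficients\<close>

text \<open>The geometric series differentiated once and twice. Truncated exponents are harmless
  because their coefficients vanish.\<close>

lemma summable_powser_diffs:
  fixes q :: real
  assumes "0 \<le> q" "q < 1"
  shows "summable (\<lambda>n. real n * q ^ (n - 1))"
    and "summable (\<lambda>n. real n * real (n - 1) * q ^ (n - 2))"
proof -
  have 0: "summable (\<lambda>n. 1 * y ^ n)" if "norm y < 1" for y :: real
    using that by (simp add: summable_geometric)
  have 1: "summable (\<lambda>n. diffs (\<lambda>_. 1) n * y ^ n)" if "norm y < 1" for y :: real
    using that 0 by (rule termdiff_converges)
  then have "summable (\<lambda>n. real (Suc n) * q ^ (Suc n - 1))"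
    using assms by (simp add: diffs_def)
  then show "summable (\<lambda>n. real n * q ^ (n - 1))"
    by (subst (asm) summable_Suc_iff)
  have "summable (\<lambda>n. diffs (diffs (\<lambda>_. 1)) n * q ^ n)"
    using assms by (intro termdiff_converges[OF _ 1]) auto
  then have "summable (\<lambda>n. real (Suc (Suc n)) * real (Suc (Suc n) - 1) * q ^ (Suc (Suc n) - 2))"
    by (simp add: diffs_def mult_ac)
  then show "summable (\<lambda>n. real n * real (n - 1) * q ^ (n - 2))"
    by (subst (asm) summable_Suc_iff, subst (asm) summable_Suc_iff)
qed

context calibrated_space
begin

lemma eigen_chain_sums:
  assumes x: "eigen_chain T z r x" and h: "cmod h < r"
  shows "(\<lambda>n. smul (h ^ n) (x (Suc n))) sums (\<Sum>n. smul (h ^ n) (x (Suc n)))"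
proof (rule summable_sums, rule summable_if_seminorms_geometric[where q = "cmod h / r"])
  have r: "0 < r"
    using x by (simp add: eigen_chain_def)
  then show "0 \<le> cmod h / r" "cmod h / r < 1"
    using h by auto
  fix p
  assume p: "p \<in> P"
  then obtain M where M: "\<And>k. p (x k) \<le> M / r ^ k"
    using x unfolding eigen_chain_def by blast
  have "p (smul (h ^ n) (x (Suc n))) \<le> M / r * (cmod h / r) ^ n" for n
    using mult_left_mono[OF M[of "Suc n"], of "cmod h ^ n"]
    by (simp add: seminorm_smul[OF seminorm_P[OF p]] norm_power power_divide mult_ac)
  then show "\<exists>C. \<forall>n. p (smul (h ^ n) (x (Suc n))) \<le> C * (cmod h / r) ^ n"
    by blast
qed

text \<open>Termwise differentiation: \<open>suminf g\<close> is the derivative, and for every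
  seminorm the error of the difference quotient is linear in \<open>w - w0\<close>, with the twice
  differentiated geometric series as constant.\<close>

lemma eigen_chain_analytic:
  assumes x: "eigen_chain T z r x"
  shows "vec_analytic_on smul (\<lambda>w. \<Sum>n. smul ((w - z) ^ n) (x (Suc n))) (ball z r)"
  unfolding vec_analytic_on_def
proof
  fix w0
  assume w0: "w0 \<in> ball z r"
  define f where "f = (\<lambda>w. \<Sum>n. smul ((w - z) ^ n) (x (Suc n)))"
  define h where "h = w0 - z"
  have r: "0 < r"
    using x by (simp add: eigen_chain_def)
  have "cmod h < r"
    using w0 by (simp add: h_def dist_norm norm_minus_commute)
  \<comment> \<open>A radius strictly in between leaves room to move \<open>w\<close> around
    \<open>w0\<close> while keeping the ratio \<open>K / r\<close> below 1.\<close>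
  then obtain K where K: "cmod h < K" "K < r"
    using dense by blast
  then have K0: "0 < K"
    by (meson norm_ge_zero order_le_less_trans)
  define q where "q = K / r"
  have q: "0 \<le> q" "q < 1"
    using K K0 r by (auto simp: q_def)
  define g where "g = (\<lambda>n. smul (of_nat n * h ^ (n - Suc 0)) (x (Suc n)))"
  have "summable g"
  proof (rule summable_if_seminorms_summable)
    fix p
    assume p: "p \<in> P"
    then obtain M where M: "\<And>k. p (x k) \<le> M / r ^ k"
      using x unfolding eigen_chain_def by blast
    have "p (g n) \<le> M / r ^ 2 * (real n * q ^ (n - 1))" for n
    proof (cases n)
      case 0
      then show ?thesis
        by (simp add: g_def seminorm_zero[OF seminorm_P[OF p]])
    next
      case (Suc k)
      have "p (g n) = real n * cmod h ^ k * p (x (Suc n))"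
        by (simp add: g_def seminorm_smul[OF seminorm_P[OF p]] Suc norm_mult norm_power del: of_nat_Suc)
      also have "\<dots> \<le> real n * K ^ k * (M / r ^ Suc n)"
        using K K0 seminorm_nonneg[OF seminorm_P[OF p]] by (intro mult_mono power_mono M) auto
      also have "\<dots> = M / r ^ 2 * (real n * q ^ (n - 1))"
        using r by (simp add: Suc q_def power_divide power2_eq_square field_simps del: of_nat_Suc)
      finally show ?thesis .
    qed
    then show "\<exists>a. summable a \<and> (\<forall>n. p (g n) \<le> a n)"
      using summable_mult[OF summable_powser_diffs(1)[OF q], of "M / r ^ 2"] by blast
  qed
  then have g: "g sums suminf g"
    by (rule summable_sums)
  have "((\<lambda>w. smul (inverse (w - w0)) (f w - f w0)) \<longlongrightarrow> suminf g) (at w0)"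
    unfolding tendsto_iff_seminorms
  proof
    fix p
    assume p: "p \<in> P"
    note sp = seminorm_P[OF p]
    obtain M where M: "\<And>k. p (x k) \<le> M / r ^ k"
      using x p unfolding eigen_chain_def by blast
    have M0: "0 \<le> M"
      using M[of 0] seminorm_nonneg[OF sp, of "x 0"] by simp
    \<comment> \<open>The power \<open>r ^ 3\<close> is what remains of
      \<open>K ^ (n - 2) / r ^ Suc n\<close> after extracting \<open>q ^ (n - 2)\<close>.\<close>
    define a where "a = (\<lambda>n. M / r ^ 3 * (real n * real (n - 1) * q ^ (n - 2)))"
    have a: "a sums suminf a"
      unfolding a_def by (intro summable_sums summable_mult summable_powser_diffs q)
    have bound: "p (smul (inverse (w - w0)) (f w - f w0) - suminf g) \<le> suminf a * cmod (w - w0)"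
      if w: "w \<noteq> w0" "cmod (w - z) < K" for w
    proof -
      define k where "k = w - w0"
      have k: "k \<noteq> 0" "w - z = h + k"
        using w by (auto simp: k_def h_def)
      define u where "u = (\<lambda>n. smul (((h + k) ^ n - h ^ n) / k - of_nat n * h ^ (n - Suc 0)) (x (Suc n)))"
      have "(\<lambda>n. smul ((h + k) ^ n) (x (Suc n))) sums f w" "(\<lambda>n. smul (h ^ n) (x (Suc n))) sums f w0"
        using eigen_chain_sums[OF x, of "w - z"] eigen_chain_sums[OF x, of h] w K
        by (auto simp: f_def k(2) simp flip: h_def)
      then have "(\<lambda>n. smul ((h + k) ^ n) (x (Suc n)) - smul (h ^ n) (x (Suc n))) sums (f w - f w0)"
        unfolding sums_def by (simp add: sum_subtractf tendsto_diff)
      then have "(\<lambda>n. smul (inverse k) (smul ((h + k) ^ n) (x (Suc n)) - smul (h ^ n) (x (Suc n))))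
          sums smul (inverse k) (f w - f w0)"
        unfolding sums_def scale_sum_right[symmetric] by (rule tendsto_smul)
      then have "(\<lambda>n. smul (inverse k) (smul ((h + k) ^ n) (x (Suc n)) - smul (h ^ n) (x (Suc n))) - g n)
          sums (smul (inverse k) (f w - f w0) - suminf g)"
        using g unfolding sums_def by (simp add: sum_subtractf tendsto_diff)
      moreover have u_eq: "u n = smul (inverse k) (smul ((h + k) ^ n) (x (Suc n)) - smul (h ^ n) (x (Suc n))) - g n" for n
        by (simp add: u_def g_def scale_left_diff_distrib scale_right_diff_distrib
            right_diff_distrib divide_inverse mult.commute)
      ultimately have u: "u sums (smul (inverse k) (f w - f w0) - suminf g)"
        by (simp only: sums_cong[OF u_eq])
      have "p (u n) \<le> a n * cmod k" for n
      proof (cases "n < 2")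
        case True
        then have "n = 0 \<or> n = 1"
          by auto
        then have "u n = 0"
          using k by (auto simp: u_def)
        then show ?thesis
          using M0 q r by (simp add: a_def seminorm_zero[OF sp])
      next
        case False
        then obtain j where j: "n = j + 2"
          by (metis add.commute le_Suc_ex not_less)
        have "p (u n) \<le> (of_nat n * of_nat (n - Suc 0) * K ^ (n - 2) * cmod k) * (M / r ^ Suc n)"
          unfolding u_def seminorm_smul[OF sp]
        proof (rule mult_mono)
          show "cmod (((h + k) ^ n - h ^ n) / k - of_nat n * h ^ (n - Suc 0)) \<le>
              of_nat n * of_nat (n - Suc 0) * K ^ (n - 2) * cmod k"
            using K k w by (intro lemma_termdiff3) auto
        qed (use M[of "Suc n"] K0 seminorm_nonneg[OF sp] in auto)
        also have "\<dots> = a n * cmod k"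
          using r by (simp add: j a_def q_def power_divide power3_eq_cube field_simps del: of_nat_Suc)
        finally show ?thesis .
      qed
      then have "p (smul (inverse k) (f w - f w0) - suminf g - sum u {..<0}) \<le>
          suminf a * cmod k - (\<Sum>n<0. a n * cmod k)"
        using a by (intro seminorm_tail_le[OF p u] sums_mult2)
      then show ?thesis
        by (simp add: k_def)
    qed
    have "open {w. cmod (w - z) < K}"
      by (intro open_Collect_less continuous_intros)
    then have "eventually (\<lambda>w. w \<in> {w. cmod (w - z) < K}) (nhds w0)"
      using K by (intro eventually_nhds_in_open) (auto simp: h_def)
    then have "eventually (\<lambda>w. norm (p (smul (inverse (w - w0)) (f w - f w0) - suminf g)) \<le>
        suminf a * cmod (w - w0)) (at w0)"
      unfolding eventually_at_filter
      by (rule eventually_mono) (use bound seminorm_nonneg[OF sp] in auto)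
    moreover have "((\<lambda>w. cmod (w - w0)) \<longlongrightarrow> 0) (at w0)"
      by (intro tendsto_norm_zero LIM_zero tendsto_ident_at)
    then have "((\<lambda>w. suminf a * cmod (w - w0)) \<longlongrightarrow> 0) (at w0)"
      by (rule tendsto_mult_right_zero)
    ultimately show "((\<lambda>w. p (smul (inverse (w - w0)) (f w - f w0) - suminf g)) \<longlongrightarrow> 0) (at w0)"
      by (rule Lim_null_comparison)
  qed
  then show "\<exists>d. ((\<lambda>w. smul (inverse (w - w0)) ((\<Sum>n. smul ((w - z) ^ n) (x (Suc n))) -
      (\<Sum>n. smul ((w0 - z) ^ n) (x (Suc n))))) \<longlongrightarrow> d) (at w0)"
    unfolding f_def by blast
qed

text \<open>The power series with coefficients \<open>x (Suc n)\<close> consists of eigenvectors, so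
  SVEP annihilates its value \<open>x 1\<close> at \<open>z\<close>. Dropping the initial 0 then
  leaves another chain, and the argument repeats.\<close>

lemma svep_eigen_chain_eq_0:
  assumes T: "T \<in> quotient_bounded smul P" and svep: "svep smul T" and x: "eigen_chain T z r x"
  shows "x k = 0"
proof -
  interpret T: Vector_Spaces.linear smul smul T
    using T by (simp add: quotient_bounded_def)
  have head: "x 1 = 0" if x: "eigen_chain T z r x" for x
  proof -
    define f where "f = (\<lambda>w. \<Sum>n. smul ((w - z) ^ n) (x (Suc n)))"
    have "smul w (f w) - T (f w) = 0" if "w \<in> ball z r" for w
    proof -
      define h where "h = w - z"
      have "cmod h < r"
        using that by (simp add: h_def dist_norm norm_minus_commute)
      then have "(\<lambda>N. \<Sum>n<N. smul (h ^ n) (x (Suc n))) \<longlonglongrightarrow> f w"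
        using eigen_chain_sums[OF x, of h] by (simp add: sums_def f_def h_def)
      \<comment> \<open>Both index ranges occur below: \<open>T\<close> maps a partial sum with
        \<open>Suc N\<close> terms to an expression containing one with \<open>N\<close>
        terms.\<close>
      note lim = this LIMSEQ_Suc[OF this]
      have "T (\<Sum>n<Suc N. smul (h ^ n) (x (Suc n))) =
          smul z (\<Sum>n<Suc N. smul (h ^ n) (x (Suc n))) + smul h (\<Sum>n<N. smul (h ^ n) (x (Suc n)))" for N
      proof -
        have "T (\<Sum>n<Suc N. smul (h ^ n) (x (Suc n))) =
            smul z (\<Sum>n<Suc N. smul (h ^ n) (x (Suc n))) + (\<Sum>n<Suc N. smul (h ^ n) (x n))"
          using x by (simp add: eigen_chain_def T.sum T.scale scale_sum_right scale_right_distrib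
              sum.distrib mult.commute del: sum.lessThan_Suc)
        also have "(\<Sum>n<Suc N. smul (h ^ n) (x n)) = smul h (\<Sum>n<N. smul (h ^ n) (x (Suc n)))"
          using x by (subst sum.lessThan_Suc_shift) (simp add: eigen_chain_def scale_sum_right)
        finally show ?thesis .
      qed
      moreover have "(\<lambda>N. T (\<Sum>n<Suc N. smul (h ^ n) (x (Suc n)))) \<longlonglongrightarrow> T (f w)"
        by (intro tendsto_quotient_bounded[OF T] lim)
      moreover have "(\<lambda>N. smul z (\<Sum>n<Suc N. smul (h ^ n) (x (Suc n))) +
          smul h (\<Sum>n<N. smul (h ^ n) (x (Suc n)))) \<longlonglongrightarrow> smul z (f w) + smul h (f w)"
        by (intro tendsto_add tendsto_smul lim)
      ultimately have "T (f w) = smul z (f w) + smul h (f w)"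
        by (simp only: LIMSEQ_unique)
      then show ?thesis
        by (simp add: h_def flip: scale_left_distrib)
    qed
    moreover have "vec_analytic_on smul f (ball z r)"
      using eigen_chain_analytic[OF x] by (simp add: f_def)
    moreover have "z \<in> ball z r"
      using x by (simp add: eigen_chain_def)
    ultimately have "f z = 0"
      using svep[unfolded svep_def, rule_format, of "ball z r" f z] by simp
    moreover have "(\<lambda>n. smul ((z - z) ^ n) (x (Suc n))) sums x (Suc 0)"
      using sums_finite[of "{0}" "\<lambda>n. smul ((z - z) ^ n) (x (Suc n))"] by (simp add: power_0_left)
    ultimately show ?thesis
      by (simp add: f_def sums_iff)
  qed
  have shift: "eigen_chain T z r (\<lambda>n. x (n + k))" for k
  proof (induction k)
    case (Suc k)
    define y where "y = (\<lambda>n. x (n + k))"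
    have y: "eigen_chain T z r y"
      using Suc by (simp add: y_def)
    then have y1: "y (Suc 0) = 0"
      using head by simp
    have "\<exists>M. \<forall>k. p (y (Suc k)) \<le> M / r ^ k" if p: "p \<in> P" for p
    proof -
      obtain M where "\<And>k. p (y k) \<le> M / r ^ k"
        using y p unfolding eigen_chain_def by blast
      then have "p (y (Suc k)) \<le> M / r / r ^ k" for k
        by (metis divide_divide_eq_left power_Suc)
      then show ?thesis by blast
    qed
    then have "eigen_chain T z r (\<lambda>n. y (Suc n))"
      using y y1 by (simp add: eigen_chain_def)
    then show ?case
      by (simp add: y_def)
  qed (use x in simp)
  show ?thesis
    using shift[of k] by (simp add: eigen_chain_def)
qed

end

section \<open>Bracket powers\<close>

context calibrated_space
begin

section \<open>Quotient bounded operators and their seminorms\<close>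

lemma quotient_bounded_id: "(\<lambda>x. x) \<in> quotient_bounded smul P"
  using vector_space_axioms
  by (auto simp: quotient_bounded_def Vector_Spaces.linear_iff intro!: exI[of _ 1])

lemma quotient_bounded_compose:
  assumes T: "T \<in> quotient_bounded smul P" and S: "S \<in> quotient_bounded smul P"
  shows "(\<lambda>x. T (S x)) \<in> quotient_bounded smul P"
proof -
  have "\<exists>c>0. \<forall>x. p (T (S x)) \<le> c * p x" if p: "p \<in> P" for p
  proof -
    obtain a b where a: "0 < a" "\<And>x. p (T x) \<le> a * p x" and b: "0 < b" "\<And>x. p (S x) \<le> b * p x"
      using T S p unfolding quotient_bounded_def by blast
    have "p (T (S x)) \<le> a * b * p x" for x
      using order_trans[OF a(2)[of "S x"] mult_left_mono[OF b(2)[of x]]] a(1) by (simp add: mult.assoc)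
    then show ?thesis
      using a(1) b(1) by (intro exI[of _ "a * b"]) simp
  qed
  then show ?thesis
    using T S by (simp add: quotient_bounded_def Vector_Spaces.linear_iff)
qed

lemma quotient_bounded_diff:
  assumes T: "T \<in> quotient_bounded smul P" and S: "S \<in> quotient_bounded smul P"
  shows "(\<lambda>x. T x - S x) \<in> quotient_bounded smul P"
proof -
  have "\<exists>c>0. \<forall>x. p (T x - S x) \<le> c * p x" if p: "p \<in> P" for p
  proof -
    obtain a b where a: "0 < a" "\<And>x. p (T x) \<le> a * p x" and b: "0 < b" "\<And>x. p (S x) \<le> b * p x"
      using T S p unfolding quotient_bounded_def by blast
    have "p (T x - S x) \<le> (a + b) * p x" for x
      using seminorm_diff_le[OF seminorm_P[OF p], of "T x" "S x"] a(2)[of x] b(2)[of x]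
      by (simp add: distrib_right)
    then show ?thesis
      using a(1) b(1) by (intro exI[of _ "a + b"]) simp
  qed
  then show ?thesis
    using T S by (simp add: quotient_bounded_def Vector_Spaces.linear_iff scale_right_diff_distrib)
qed

text \<open>The infimum is itself admissible: where \<open>p x\<close> is 0 any admissible constant
  forces \<open>p (A x)\<close> to vanish, elsewhere one divides by \<open>p x\<close>.\<close>

lemma op_seminorm_bound:
  assumes A: "A \<in> quotient_bounded smul P" and p: "p \<in> P"
  shows "0 \<le> op_seminorm p A" and "p (A x) \<le> op_seminorm p A * p x"
proof -
  let ?R = "{r. 0 < r \<and> (\<forall>x. p (A x) \<le> r * p x)}"
  have ne: "?R \<noteq> {}"
    using A p by (auto simp: quotient_bounded_def)
  show "0 \<le> op_seminorm p A"
    unfolding op_seminorm_def by (rule cInf_greatest[OF ne]) auto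
  show "p (A x) \<le> op_seminorm p A * p x"
  proof (cases "p x = 0")
    case True
    obtain r where "p (A x) \<le> r * p x"
      using ne by blast
    with True show ?thesis
      by simp
  next
    case False
    then have pos: "0 < p x"
      using seminorm_nonneg[OF seminorm_P[OF p], of x] by simp
    have "p (A x) / p x \<le> op_seminorm p A"
      unfolding op_seminorm_def using pos by (intro cInf_greatest[OF ne]) (auto simp: divide_le_eq)
    then show ?thesis
      using pos by (simp add: divide_le_eq)
  qed
qed

lemma bracket_power_0: "bracket_power smul T S 0 x = x"
  by (simp add: bracket_power_def)

text \<open>Left multiplication by \<open>T\<close> and right multiplication by \<open>S\<close>
  commute, and the bracket power is the \<open>n\<close>-th power of their difference applied to the
  identity.\<close>

lemma bracket_power_Suc:
  assumes T: "Vector_Spaces.linear smul smul T"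
  shows "bracket_power smul T S (Suc n) x =
    T (bracket_power smul T S n x) - bracket_power smul T S n (S x)"
proof -
  interpret T: Vector_Spaces.linear smul smul T by fact
  \<comment> \<open>With the sign inside \<open>c\<close>, raising \<open>j\<close> accounts for the
    minus sign of the second term.\<close>
  define c where "c = (\<lambda>m j. smul ((-1) ^ j) ((T ^^ m) ((S ^^ j) x)))"
  have eq: "bracket_power smul T S n x = (\<Sum>m\<le>n. smul (of_nat (n choose m)) (c m (n - m)))" for n
    by (simp add: bracket_power_def c_def atLeast0AtMost mult.commute)
  have "bracket_power smul T S n (S x) =
      (\<Sum>m\<le>n. smul (of_nat (n choose m)) (smul ((-1) ^ (n - m)) ((T ^^ m) ((S ^^ Suc (n - m)) x))))"
    by (simp add: bracket_power_def atLeast0AtMost mult.commute funpow_Suc_right del: funpow.simps)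
  then have *: "bracket_power smul T S n (S x) =
      - (\<Sum>m\<le>n. smul (of_nat (n choose m)) (c m (Suc (n - m))))"
    by (simp add: c_def sum_negf)
  have "T (bracket_power smul T S n x) = (\<Sum>m\<le>n. smul (of_nat (n choose m)) (c (Suc m) (n - m)))"
    by (simp add: eq T.sum T.scale c_def)
  with * show ?thesis
    unfolding eq[of "Suc n"] Pascal_sum by (simp add: scale_right_distrib sum.distrib)
qed

lemma quotient_bounded_bracket_power:
  assumes T: "T \<in> quotient_bounded smul P" and S: "S \<in> quotient_bounded smul P"
  shows "bracket_power smul T S n \<in> quotient_bounded smul P"
proof (induction n)
  case 0
  have "bracket_power smul T S 0 = (\<lambda>x. x)"
    by (simp add: fun_eq_iff bracket_power_0)
  then show ?case
    using quotient_bounded_id by simp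
next
  case (Suc n)
  have "bracket_power smul T S (Suc n) =
      (\<lambda>x. T (bracket_power smul T S n x) - bracket_power smul T S n (S x))"
    using T by (simp add: fun_eq_iff bracket_power_Suc quotient_bounded_def)
  then show ?case
    using quotient_bounded_diff[OF quotient_bounded_compose[OF T Suc] quotient_bounded_compose[OF Suc S]]
    by simp
qed

text \<open>Formally, the exponential generating functions exp(tT) exp(-tS) and exp(tS) exp(-tT) are
  inverse to each other. The proof shows that each convolution sum is the commutator of
  \<open>T\<close> with the preceding one, and the first is the identity.\<close>

lemma bracket_power_convolution:
  assumes T: "T \<in> quotient_bounded smul P" and S: "S \<in> quotient_bounded smul P"
  shows "(\<Sum>m\<le>N. smul (of_nat (N choose m)) (bracket_power smul T S m (bracket_power smul S T (N - m) x))) =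
    (if N = 0 then x else 0)"
proof (induction N arbitrary: x)
  case 0
  then show ?case
    by (simp add: bracket_power_0)
next
  case (Suc N)
  interpret T: Vector_Spaces.linear smul smul T
    using T by (simp add: quotient_bounded_def)
  have S_lin: "Vector_Spaces.linear smul smul S"
    using S by (simp add: quotient_bounded_def)
  have diff: "bracket_power smul T S m (x - y) = bracket_power smul T S m x - bracket_power smul T S m y" for m x y
  proof -
    interpret B: Vector_Spaces.linear smul smul "bracket_power smul T S m"
      using quotient_bounded_bracket_power[OF T S] by (simp add: quotient_bounded_def)
    show ?thesis by (rule B.diff)
  qed
  define c where "c = (\<lambda>x m j. bracket_power smul T S m (bracket_power smul S T j x))"
  define E where "E = (\<lambda>N x. \<Sum>m\<le>N. smul (of_nat (N choose m)) (c x m (N - m)))"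
  \<comment> \<open>The two recursions contribute the same middle term containing \<open>S\<close>
    with opposite signs.\<close>
  have "c x (Suc m) j + c x m (Suc j) = T (c x m j) - c (T x) m j" for m j
    by (simp add: c_def bracket_power_Suc[OF T.linear_axioms] bracket_power_Suc[OF S_lin] diff)
  then have "E (Suc N) x = T (E N x) - E N (T x)"
    unfolding E_def Pascal_sum by (simp add: T.sum T.scale scale_right_diff_distrib sum_subtractf)
  moreover have "E N y = (if N = 0 then y else 0)" for y
    using Suc[of y] by (simp add: E_def c_def)
  ultimately have "E (Suc N) x = 0"
    by simp
  then show ?case
    by (simp add: E_def c_def del: sum.atMost_Suc)
qed

lemma op_seminorm_root_bound:
  assumes A: "\<And>n. A n \<in> quotient_bounded smul P" and p: "p \<in> P"
    and lim: "(\<lambda>n. root n (op_seminorm p (A n))) \<longlonglongrightarrow> 0" and e: "0 < e"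
  obtains C where "0 \<le> C" "\<And>n x. p (A n x) \<le> C * e ^ n * p x"
proof -
  note nonneg = op_seminorm_bound(1)[OF A p]
  have "eventually (\<lambda>n. root n (op_seminorm p (A n)) < e) sequentially"
    using lim e by (rule order_tendstoD)
  then obtain N where N: "\<And>n. N \<le> n \<Longrightarrow> root n (op_seminorm p (A n)) < e"
    by (auto simp: eventually_sequentially)
  \<comment> \<open>The sum absorbs the initial segment, including index 0 where
    \<open>root 0\<close> is a default value; the summand 1 covers the indices beyond
    \<open>N\<close>.\<close>
  define C where "C = 1 + (\<Sum>n\<le>N. op_seminorm p (A n) / e ^ n)"
  have s: "0 \<le> (\<Sum>n\<le>N. op_seminorm p (A n) / e ^ n)"
    using e nonneg by (intro sum_nonneg) auto
  have le: "op_seminorm p (A n) \<le> C * e ^ n" for n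
  proof (cases "n \<le> N")
    case True
    then have "op_seminorm p (A n) / e ^ n \<le> (\<Sum>n\<le>N. op_seminorm p (A n) / e ^ n)"
      using e nonneg by (intro member_le_sum) auto
    then show ?thesis
      using e by (simp add: C_def divide_le_eq distrib_right add_increasing)
  next
    case False
    then have n: "0 < n" "N \<le> n"
      by auto
    have "op_seminorm p (A n) = root n (op_seminorm p (A n)) ^ n"
      using n nonneg by simp
    also have "\<dots> \<le> e ^ n"
      using N[OF n(2)] nonneg n by (intro power_mono) auto
    also have "\<dots> \<le> C * e ^ n"
      using s e by (simp add: C_def distrib_right)
    finally show ?thesis .
  qed
  show thesis
  proof (rule that[of C])
    show "0 \<le> C"
      using s by (simp add: C_def)
    show "p (A n x) \<le> C * e ^ n * p x" for n x
      using op_seminorm_bound(2)[OF A p, of n x] mult_right_mono[OF le[of n]]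
        seminorm_nonneg[OF seminorm_P[OF p], of x] by (meson order_trans)
  qed
qed

end

section \<open>Transfer between quasi-nilpotent equivalent operators\<close>

context calibrated_space
begin

text \<open>
  For an analytic family \<open>f\<close> of eigenvectors of \<open>T\<close> with Taylor coefficients \<open>f\<^sub>k\<close>, the vectors
  \<open>transfer S T x (Suc m)\<close> are the Taylor coefficients of \<open>\<Sum>n. (-1)\<^sup>n (S - T)\<^sup>[\<^sup>n\<^sup>] f\<^sup>(\<^sup>n\<^sup>) / n!\<close>,
  where \<open>x (Suc k) = f\<^sub>k\<close>. For \<open>m = 0\<close> truncated subtraction makes the terms with \<open>n > 0\<close> vanish.
\<close>

definition transfer_term ::
    "('a \<Rightarrow> 'a) \<Rightarrow> ('a \<Rightarrow> 'a) \<Rightarrow> (nat \<Rightarrow> 'a) \<Rightarrow> nat \<Rightarrow> nat \<Rightarrow> 'a" where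
  "transfer_term S T x m n =
    smul ((-1) ^ n * of_nat ((m + n - 1) choose n)) (bracket_power smul S T n (x (m + n)))"

definition transfer :: "('a \<Rightarrow> 'a) \<Rightarrow> ('a \<Rightarrow> 'a) \<Rightarrow> (nat \<Rightarrow> 'a) \<Rightarrow> nat \<Rightarrow> 'a" where
  "transfer S T x m = (\<Sum>n. transfer_term S T x m n)"

lemma transfer_weight_le: "cmod ((-1) ^ n * of_nat ((m + n - 1) choose n)) \<le> 2 ^ (m + n)"
proof -
  have "real ((m + n - 1) choose n) \<le> real (2 ^ (m + n - 1))"
    by (intro of_nat_mono binomial_le_pow2)
  also have "\<dots> \<le> 2 ^ (m + n)"
    by (simp add: power_increasing)
  finally show ?thesis
    by (simp add: norm_mult norm_power)
qed

text \<open>The weight \<open>2 ^ (m + n)\<close> and the growth \<open>M / r ^ (m + n)\<close>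
  produce \<open>(2 / r) ^ m\<close>, which is why the radius of the transferred chain is
  \<open>r / 2\<close>. Against \<open>(2 / r) ^ n\<close> the rate \<open>r / 8\<close> leaves
  \<open>(1 / 4) ^ n\<close>.\<close>

lemma bracket_term_bound:
  assumes p: "p \<in> P" and r: "0 < r" and C: "0 \<le> C"
    and A: "\<And>n y. p (bracket_power smul S T n y) \<le> C * (r / 8) ^ n * p y"
    and M: "\<And>k. p (x k) \<le> M / r ^ k" and a: "cmod a \<le> 2 ^ (m + n)"
  shows "p (smul a (bracket_power smul S T n (x (m + n)))) \<le> C * M * (2 / r) ^ m * (1 / 4) ^ n"
proof -
  note sp = seminorm_P[OF p]
  have "p (bracket_power smul S T n (x (m + n))) \<le> C * (r / 8) ^ n * (M / r ^ (m + n))"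
    using order_trans[OF A[of n "x (m + n)"] mult_left_mono[OF M[of "m + n"], of "C * (r / 8) ^ n"]] C r by simp
  then have "p (smul a (bracket_power smul S T n (x (m + n)))) \<le>
      2 ^ (m + n) * (C * (r / 8) ^ n * (M / r ^ (m + n)))"
    using a seminorm_nonneg[OF sp] unfolding seminorm_smul[OF sp] by (intro mult_mono) auto
  also have "\<dots> = C * M * (2 / r) ^ m * ((2 / r) ^ n * (r / 8) ^ n)"
    by (simp add: power_add power_divide mult_ac)
  also have "(2 / r) ^ n * (r / 8) ^ n = (1 / 4) ^ n"
    using r by (simp flip: power_mult_distrib)
  finally show ?thesis .
qed

context
  fixes S T :: "'a \<Rightarrow> 'a" and z :: complex and r :: real and x :: "nat \<Rightarrow> 'a"
  assumes S: "S \<in> quotient_bounded smul P" and T: "T \<in> quotient_bounded smul P"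
    and x: "eigen_chain T z r x"
    and growth: "\<And>p e. p \<in> P \<Longrightarrow> 0 < e \<Longrightarrow>
      \<exists>C\<ge>0. \<forall>n y. p (bracket_power smul S T n y) \<le> C * e ^ n * p y"
begin

lemma bracket_term_bound_ex:
  assumes p: "p \<in> P"
  obtains C where "0 \<le> C" "\<And>m n a. cmod a \<le> 2 ^ (m + n) \<Longrightarrow>
    p (smul a (bracket_power smul S T n (x (m + n)))) \<le> C * (2 / r) ^ m * (1 / 4) ^ n"
proof -
  have r: "0 < r"
    using x by (simp add: eigen_chain_def)
  obtain C where C: "0 \<le> C" "\<And>n y. p (bracket_power smul S T n y) \<le> C * (r / 8) ^ n * p y"
    using growth[OF p, of "r / 8"] r by auto
  obtain M where M: "\<And>k. p (x k) \<le> M / r ^ k"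
    using x p unfolding eigen_chain_def by blast
  have "0 \<le> M"
    using M[of 0] seminorm_nonneg[OF seminorm_P[OF p], of "x 0"] by simp
  then show thesis
    using C(1) by (intro that[of "C * M"] bracket_term_bound[OF p r C M]) simp
qed

lemma transfer_term_bound_ex:
  assumes p: "p \<in> P"
  obtains C where "0 \<le> C" "\<And>m n. p (transfer_term S T x m n) \<le> C * (2 / r) ^ m * (1 / 4) ^ n"
  using bracket_term_bound_ex[OF p] transfer_weight_le unfolding transfer_term_def by metis

lemma transfer_sums: "transfer_term S T x m sums transfer S T x m"
  unfolding transfer_def
proof (rule summable_sums, rule summable_if_seminorms_geometric[where q = "1 / 4"])
  fix p
  assume "p \<in> P"
  then obtain C where "\<And>m n. p (transfer_term S T x m n) \<le> C * (2 / r) ^ m * (1 / 4) ^ n"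
    using transfer_term_bound_ex by metis
  then show "\<exists>C. \<forall>n. p (transfer_term S T x m n) \<le> C * (1 / 4) ^ n"
    by blast
qed auto

text \<open>Moving \<open>S\<close> past the \<open>n\<close>-th bracket power leaves the next
  bracket power and a term containing \<open>T\<close>, which the chain equation evaluates. The
  leftover bracket power merges with the next summand by Pascal's rule, so a single boundary term
  remains.\<close>

lemma transfer_term_eigen:
  "(\<Sum>n<N. S (transfer_term S T x (Suc m) n)) - smul z (\<Sum>n<N. transfer_term S T x (Suc m) n) =
    (\<Sum>n<N. transfer_term S T x m n) +
      (case N of 0 \<Rightarrow> 0 | Suc n \<Rightarrow>
        smul ((-1) ^ n * of_nat ((m + n) choose n)) (bracket_power smul S T (Suc n) (x (Suc (m + n)))))"
proof (induction N)
  case (Suc N)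
  interpret S: Vector_Spaces.linear smul smul S
    using S by (simp add: quotient_bounded_def)
  interpret A: Vector_Spaces.linear smul smul "bracket_power smul S T N"
    using quotient_bounded_bracket_power[OF S T] by (simp add: quotient_bounded_def)
  define y where "y = bracket_power smul S T (Suc N) (x (Suc (m + N)))"
  define v where "v = bracket_power smul S T N (x (m + N))"
  have "S (bracket_power smul S T N (x (Suc (m + N)))) =
      y + bracket_power smul S T N (T (x (Suc (m + N))))"
    by (simp add: y_def bracket_power_Suc[OF S.linear_axioms])
  also have "T (x (Suc (m + N))) = smul z (x (Suc (m + N))) + x (m + N)"
    using x by (simp add: eigen_chain_def)
  finally have "S (bracket_power smul S T N (x (Suc (m + N)))) =
      y + (smul z (bracket_power smul S T N (x (Suc (m + N)))) + v)"
    by (simp add: A.add A.scale v_def)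
  then have step: "S (transfer_term S T x (Suc m) N) - smul z (transfer_term S T x (Suc m) N) =
      smul ((-1) ^ N * of_nat ((m + N) choose N)) (y + v)"
    by (simp add: transfer_term_def S.scale scale_right_distrib mult.commute)
  have "(case N of 0 \<Rightarrow> 0 | Suc n \<Rightarrow>
        smul ((-1) ^ n * of_nat ((m + n) choose n)) (bracket_power smul S T (Suc n) (x (Suc (m + n))))) +
      smul ((-1) ^ N * of_nat ((m + N) choose N)) v = transfer_term S T x m N"
  proof (cases N)
    case 0
    then show ?thesis
      by (simp add: transfer_term_def v_def)
  next
    case (Suc n)
    \<comment> \<open>Pascal's rule with alternating signs: the old boundary term lowers the
      binomial coefficient of the new summand.\<close>
    have "(-1) ^ n * of_nat ((m + n) choose n) + (-1) ^ N * of_nat ((m + N) choose N) =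
        ((-1) ^ N * of_nat ((m + N - 1) choose N) :: complex)"
      by (simp add: Suc algebra_simps)
    from arg_cong[OF this, of "\<lambda>a. smul a v"] show ?thesis
      by (simp only: scale_left_distrib Suc nat.case transfer_term_def v_def add_Suc_right)
  qed
  then show ?case
    using Suc step by (simp add: y_def scale_right_distrib algebra_simps)
qed simp

text \<open>The chain equation is the limit of \<open>transfer_term_eigen\<close>, whose boundary
  term tends to 0 in every seminorm.\<close>

theorem eigen_chain_transfer: "eigen_chain S z (r / 2) (transfer S T x)"
  unfolding eigen_chain_def
proof (intro conjI allI ballI)
  show r: "0 < r / 2"
    using x by (simp add: eigen_chain_def)
  \<comment> \<open>The term with \<open>n = 0\<close> contains \<open>x 0 = 0\<close>; in the
    others the binomial coefficient of \<open>n\<close> over \<open>n - 1\<close> vanishes.\<close>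
  have "transfer_term S T x 0 n = 0" for n
    using x by (cases n) (simp_all add: transfer_term_def bracket_power_0 eigen_chain_def binomial_eq_0)
  then show "transfer S T x 0 = 0"
    by (simp add: transfer_def)
  fix p
  assume p: "p \<in> P"
  obtain C where C: "0 \<le> C" "\<And>m n. p (transfer_term S T x m n) \<le> C * (2 / r) ^ m * (1 / 4) ^ n"
    using transfer_term_bound_ex[OF p] by blast
  have "p (transfer S T x m - (\<Sum>n<0. transfer_term S T x m n)) \<le> C * (2 / r) ^ m * (1 / 4) ^ 0 / (1 - 1 / 4)" for m
    by (rule seminorm_geometric_tail_le[OF p transfer_sums C(2)]) auto
  then have "p (transfer S T x m) \<le> C * (4 / 3) / (r / 2) ^ m" for m
    using r by (simp add: power_divide mult_ac)
  then show "\<exists>M. \<forall>k. p (transfer S T x k) \<le> M / (r / 2) ^ k"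
    by blast
next
  fix m
  interpret S: Vector_Spaces.linear smul smul S
    using S by (simp add: quotient_bounded_def)
  define e where "e = (\<lambda>n. smul ((-1) ^ n * of_nat ((m + n) choose n))
      (bracket_power smul S T (Suc n) (x (Suc (m + n)))))"
  have lim: "(\<lambda>N. \<Sum>n<Suc N. transfer_term S T x k n) \<longlonglongrightarrow> transfer S T x k" for k
    using transfer_sums[of k] unfolding sums_def by (rule LIMSEQ_Suc)
  have "e \<longlonglongrightarrow> 0"
    unfolding tendsto_iff_seminorms
  proof
    fix p
    assume p: "p \<in> P"
    obtain C where C: "\<And>n a. cmod a \<le> 2 ^ (m + n) \<Longrightarrow>
        p (smul a (bracket_power smul S T n (x (m + n)))) \<le> C * (2 / r) ^ m * (1 / 4) ^ n"
      using bracket_term_bound_ex[OF p] by metis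
    \<comment> \<open>The boundary term contains the bracket power of order \<open>Suc n\<close> at
      \<open>x (m + Suc n)\<close>, so the general bound applies at \<open>Suc n\<close>.\<close>
    have "norm (p (e n - 0)) \<le> C * (2 / r) ^ m * (1 / 4) ^ Suc n" for n
    proof -
      have "real ((m + n) choose n) \<le> real (2 ^ (m + n))"
        by (intro of_nat_mono binomial_le_pow2)
      also have "\<dots> \<le> 2 ^ (m + Suc n)"
        by simp
      finally show ?thesis
        using C[of "(-1) ^ n * of_nat ((m + n) choose n)" "Suc n"] seminorm_nonneg[OF seminorm_P[OF p]]
        by (simp add: e_def norm_mult norm_power)
    qed
    then have "\<forall>n. norm (p (e n - 0)) \<le> C * (2 / r) ^ m * (1 / 4) ^ Suc n" ..
    moreover have "(\<lambda>n. C * (2 / r) ^ m * (1 / 4) ^ Suc n) \<longlonglongrightarrow> 0"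
      by (intro tendsto_mult_right_zero LIMSEQ_Suc LIMSEQ_power_zero) simp
    ultimately show "(\<lambda>n. p (e n - 0)) \<longlonglongrightarrow> 0"
      by (rule Lim_null_comparison[OF always_eventually])
  qed
  then have lim1: "(\<lambda>N. (\<Sum>n<Suc N. transfer_term S T x m n) + e N) \<longlonglongrightarrow> transfer S T x m + 0"
    by (intro tendsto_add lim)
  have lim2: "(\<lambda>N. S (\<Sum>n<Suc N. transfer_term S T x (Suc m) n) -
        smul z (\<Sum>n<Suc N. transfer_term S T x (Suc m) n)) \<longlonglongrightarrow>
      S (transfer S T x (Suc m)) - smul z (transfer S T x (Suc m))"
    by (intro tendsto_diff tendsto_quotient_bounded[OF S] tendsto_smul lim)
  have eq: "S (\<Sum>n<Suc N. transfer_term S T x (Suc m) n) -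
      smul z (\<Sum>n<Suc N. transfer_term S T x (Suc m) n) = (\<Sum>n<Suc N. transfer_term S T x m n) + e N" for N
    unfolding S.sum transfer_term_eigen by (simp add: e_def)
  have "S (transfer S T x (Suc m)) - smul z (transfer S T x (Suc m)) = transfer S T x m + 0"
    using lim2 lim1 unfolding eq by (rule LIMSEQ_unique)
  then show "S (transfer S T x (Suc m)) = smul z (transfer S T x (Suc m)) + transfer S T x m"
    by (simp add: diff_eq_eq add.commute)
qed

text \<open>
  The inverse of the transfer is the transfer with \<open>S\<close> and \<open>T\<close> exchanged, so that the leading
  coefficient of \<open>x\<close> is recovered from \<open>transfer S T x\<close>.
\<close>

lemma transfer_eq_0_imp:
  assumes zero: "\<And>m. transfer S T x m = 0"
    and growth': "\<And>p e. p \<in> P \<Longrightarrow> 0 < e \<Longrightarrow>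
      \<exists>C\<ge>0. \<forall>n y. p (bracket_power smul T S n y) \<le> C * e ^ n * p y"
  shows "x 1 = 0"
proof (rule eq_zero_if_seminorms_zero)
  fix p
  assume p: "p \<in> P"
  note sp = seminorm_P[OF p]
  have r: "0 < r"
    using x by (simp add: eigen_chain_def)
  obtain B where B: "0 \<le> B" "\<And>n y. p (bracket_power smul T S n y) \<le> B * (r / 8) ^ n * p y"
    using growth'[OF p, of "r / 8"] r by auto
  obtain C where C: "0 \<le> C" "\<And>m n. p (transfer_term S T x m n) \<le> C * (2 / r) ^ m * (1 / 4) ^ n"
    using transfer_term_bound_ex[OF p] by blast
  \<comment> \<open>Only finite sums are rearranged: \<open>x 1\<close> is a double sum over the
    triangle \<open>m + n \<le> K\<close>, and for fixed \<open>m\<close> the inner sum involves a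
    partial sum of a vanishing transfer, hence just its tail.\<close>
  have "p (x 1) \<le> real (K + 1) * (B * C * 2 / (3 * r) * (1 / 4) ^ K) * 1" for K
  proof -
    define g where "g = (\<lambda>m n. smul ((-1) ^ (m + n) * of_nat ((m + n) choose m))
        (bracket_power smul T S m (bracket_power smul S T n (x (Suc (m + n))))))"
    \<comment> \<open>Along each antidiagonal the convolution identity applies; only the one with
      \<open>N = 0\<close> contributes.\<close>
    have "(\<Sum>N\<le>K. \<Sum>m\<le>N. g m (N - m)) = (\<Sum>N\<le>K. if N = 0 then x 1 else 0)"
    proof (intro sum.cong refl)
      fix N
      have "(\<Sum>m\<le>N. g m (N - m)) = smul ((-1) ^ N) (\<Sum>m\<le>N. smul (of_nat (N choose m))
          (bracket_power smul T S m (bracket_power smul S T (N - m) (x (Suc N)))))"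
        by (simp add: g_def scale_sum_right)
      also have "\<dots> = smul ((-1) ^ N) (if N = 0 then x (Suc N) else 0)"
        by (simp only: bracket_power_convolution[OF T S])
      finally show "(\<Sum>m\<le>N. g m (N - m)) = (if N = 0 then x 1 else 0)"
        by simp
    qed
    also have "\<dots> = x 1"
      by simp
    finally have "x 1 = (\<Sum>(m, n)\<in>{(m, n). m + n \<le> K}. g m n)"
      by (simp only: sum.triangle_reindex_eq)
    also have "{(m, n). m + n \<le> K} = Sigma {..K} (\<lambda>m. {..K - m})"
      by auto
    also have "(\<Sum>(m, n)\<in>Sigma {..K} (\<lambda>m. {..K - m}). g m n) = (\<Sum>m\<le>K. \<Sum>n\<le>K - m. g m n)"
      by (rule sum.Sigma[symmetric]) auto
    finally have x1: "x 1 = (\<Sum>m\<le>K. \<Sum>n\<le>K - m. g m n)" .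
    have le: "p (\<Sum>n\<le>K - m. g m n) \<le> B * C * 2 / (3 * r) * (1 / 4) ^ K" if m: "m \<le> K" for m
    proof -
      interpret B: Vector_Spaces.linear smul smul "bracket_power smul T S m"
        using quotient_bounded_bracket_power[OF T S] by (simp add: quotient_bounded_def)
      define v where "v = (\<Sum>n<Suc (K - m). transfer_term S T x (Suc m) n)"
      \<comment> \<open>The weights agree because \<open>Suc m + n - 1 = m + n\<close> and the
        binomial coefficient is symmetric.\<close>
      have "g m n = smul ((-1) ^ m) (bracket_power smul T S m (transfer_term S T x (Suc m) n))" for n
        using binomial_symmetric[of m "m + n"]
        by (simp add: g_def transfer_term_def B.scale power_add mult.assoc)
      then have eq: "(\<Sum>n\<le>K - m. g m n) = smul ((-1) ^ m) (bracket_power smul T S m v)"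
        by (simp only: v_def lessThan_Suc_atMost B.sum scale_sum_right)
      have "p (transfer S T x (Suc m) - v) \<le> C * (2 / r) ^ Suc m * (1 / 4) ^ Suc (K - m) / (1 - 1 / 4)"
        unfolding v_def by (rule seminorm_geometric_tail_le[OF p transfer_sums C(2)]) auto
      \<comment> \<open>As the full sum is 0, the partial sum \<open>v\<close> is minus its
        tail.\<close>
      then have v: "p v \<le> C * (2 / r) ^ Suc m * (1 / 4) ^ Suc (K - m) / (1 - 1 / 4)"
        by (simp add: zero seminorm_minus[OF sp])
      have "p (\<Sum>n\<le>K - m. g m n) = p (bracket_power smul T S m v)"
        by (simp add: eq seminorm_smul[OF sp] norm_power)
      also have "\<dots> \<le> B * (r / 8) ^ m * p v"
        by (rule B(2))
      also have "\<dots> \<le> B * (r / 8) ^ m * (C * (2 / r) ^ Suc m * (1 / 4) ^ Suc (K - m) / (1 - 1 / 4))"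
        using B(1) r by (intro mult_left_mono v) auto
      \<comment> \<open>The outer decay in \<open>m\<close> and the tail decay in
        \<open>K - m\<close> have the same rate 1/4, so the bound does not depend on
        \<open>m\<close>.\<close>
      also have "\<dots> = B * C * 2 / (3 * r) * (((r / 8) ^ m * (2 / r) ^ m) * (1 / 4) ^ (K - m))"
        by (simp add: mult_ac)
      also have "(r / 8) ^ m * (2 / r) ^ m = (1 / 4) ^ m"
        using r by (simp flip: power_mult_distrib)
      also have "(1 / 4) ^ m * (1 / 4) ^ (K - m) = (1 / 4 :: real) ^ K"
        using m by (simp flip: power_add)
      finally show ?thesis .
    qed
    have "p (x 1) \<le> (\<Sum>m\<le>K. p (\<Sum>n\<le>K - m. g m n))"
      unfolding x1 by (rule seminorm_sum_le[OF sp])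
    also have "\<dots> \<le> (\<Sum>m\<le>K. B * C * 2 / (3 * r) * (1 / 4) ^ K)"
      by (intro sum_mono le) simp
    finally show ?thesis
      by simp
  qed
  moreover have "(\<lambda>K. real (K + 1) * (B * C * 2 / (3 * r) * (1 / 4) ^ K)) \<longlonglongrightarrow> 0"
    by real_asymp
  ultimately have "p (x 1) \<le> 0"
    by (intro LIMSEQ_le_const) auto
  then show "p (x 1) = 0"
    using seminorm_nonneg[OF sp, of "x 1"] by simp
qed

end

lemma quasi_nilpotent_equivalent_growth:
  assumes S: "S \<in> quotient_bounded smul P" and T: "T \<in> quotient_bounded smul P"
    and q: "quasi_nilpotent_equivalent smul P S T" and p: "p \<in> P" and e: "0 < e"
  shows "\<exists>C\<ge>0. \<forall>n y. p (bracket_power smul S T n y) \<le> C * e ^ n * p y"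
proof -
  have "(\<lambda>n. root n (op_seminorm p (bracket_power smul S T n))) \<longlonglongrightarrow> 0"
    using q p by (simp add: quasi_nilpotent_equivalent_def)
  then obtain C where "0 \<le> C" "\<And>n y. p (bracket_power smul S T n y) \<le> C * e ^ n * p y"
    using op_seminorm_root_bound[where A = "bracket_power smul S T",
        OF quotient_bounded_bracket_power[OF S T] p _ e] by metis
  then show ?thesis by blast
qed

text \<open>SVEP for \<open>S\<close> annihilates the transferred chain, and invertibility of the
  transfer then annihilates \<open>x 1 = f z\<close>.\<close>

theorem svep_if_quasi_nilpotent_equivalent:
  assumes S: "S \<in> quotient_bounded smul P" and T: "T \<in> quotient_bounded smul P"
    and q: "quasi_nilpotent_equivalent smul P S T" and svep: "svep smul S"
  shows "svep smul T"
  unfolding svep_def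
proof (intro allI impI ballI)
  fix D f z
  assume D: "open D" and f: "vec_analytic_on smul f D"
    and eig: "\<forall>w\<in>D. smul w (f w) - T (f w) = 0" and z: "z \<in> D"
  have q': "quasi_nilpotent_equivalent smul P T S"
    using q by (auto simp: quasi_nilpotent_equivalent_def)
  have "T (f w) = smul w (f w)" if "w \<in> D" for w
    using eig that by simp
  then obtain x r where x: "eigen_chain T z r x" "x 1 = f z"
    using eigen_chain_Taylor[OF T f D _ z] by blast
  note growth = quasi_nilpotent_equivalent_growth[OF S T q]
  note growth' = quasi_nilpotent_equivalent_growth[OF T S q']
  have zero: "transfer S T x m = 0" for m
    by (rule svep_eigen_chain_eq_0[OF S svep eigen_chain_transfer[OF S T x(1) growth]])
  have "x 1 = 0"
    by (rule transfer_eq_0_imp[OF S T x(1) growth zero growth'])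
  with x show "f z = 0"
    by simp
qed

end

theorem theorem3p10:
  fixes smul :: "complex \<Rightarrow> 'a::{topological_ab_group_add, t2_space} \<Rightarrow> 'a"
    and P :: "('a \<Rightarrow> real) set"
    and T S :: "'a \<Rightarrow> 'a"
  assumes "complex_lcs smul"
    and "seq_complete TYPE('a)"
    and "calibration smul P"
    and "T \<in> quotient_bounded_0 smul P"
    and "S \<in> quotient_bounded_0 smul P"
    and "quasi_nilpotent_equivalent smul P T S"
  shows "svep smul T \<longleftrightarrow> svep smul S"
proof -
  interpret calibrated_space smul P
    using assms by (simp add: calibrated_space_def calibrated_space_axioms_def
        complex_vector_space_def complex_lcs_def)
  have T: "T \<in> quotient_bounded smul P" and S: "S \<in> quotient_bounded smul P"
    using assms by (simp_all add: quotient_bounded_0_def)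
  have "quasi_nilpotent_equivalent smul P S T"
    using assms by (auto simp: quasi_nilpotent_equivalent_def)
  \<comment> \<open>The equivalence relation is symmetric, so the one-sided transfer yields both
    implications.\<close>
  then show ?thesis
    using svep_if_quasi_nilpotent_equivalent S T assms(6) by blast
qed

end
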